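(* Let $M$ be a closed, connected $C^\infty$ manifold of dimension $d\ge 1$, let $H:T^*M\to\mathbb{R}$ be a Hamiltonian of class $C^r$ with $r\ge 1$, let $\Gamma\subset T^*M$ be a Lagrangian graph of class $C^1$, and let $\Lambda\subseteq\Gamma$ be a compact, connected set that is invariant under the Hamiltonian flow $\phi^t_H$. Suppose that for any two points of $\Lambda$ there is a rectifiable path contained in $\Lambda$ that connects them. Then $H$ is constant on $\Lambda$.
   Context: $T^*M$ carries its canonical symplectic form $\omega$; $X_H$ is the Hamiltonian vector field of $H$, given in canonical local coordinates $(q,p)$ by $\dot q=\partial H/\partial p$, $\dot p=-\partial H/\partial q$, and $\phi^t_H$ is its flow. A set $\Lambda\subset T^*M$ is invariant under $\phi^t_H$ if $\phi^t_H(\Lambda)=\Lambda$ for all $t\in\mathbb{R}$. If $H$ is only $C^1$, so that $X_H$ is merely continuous and its integral curves need not be unique, this is understood to mean that through every point of $\Lambda$ there passes an integral curve $\mathbb{R}\to T^*M$ of $X_H$ contained in $\Lambda$. A Lagrangian graph of class $C^1$ is the image of a $C^1$ section $q\mapsto(q,\Gamma(q))$ of $T^*M\to M$ such that $\Gamma$ is a closed 1-form (locally the differential of a $C^2$ function). A rectifiable path is a continuous path of finite length with respect to some (equivalently, any) Riemannian metric on $T^*M$. *)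

theory Defs
  imports "HOL-Analysis.Analysis"
begin

section \<open>Functions of class $C^k$ on open subsets of Euclidean spaces\<close>

primrec Cn_on :: "nat \<Rightarrow> 'e::euclidean_space set \<Rightarrow> ('e \<Rightarrow> 'b::real_normed_vector) \<Rightarrow> bool" where
  "Cn_on 0 S f \<longleftrightarrow> continuous_on S f"
| "Cn_on (Suc n) S f \<longleftrightarrow>
     (\<forall>x\<in>S. f differentiable (at x)) \<and> (\<forall>v. Cn_on n S (\<lambda>x. frechet_derivative f (at x) v))"

definition Cr_on :: "enat \<Rightarrow> 'e::euclidean_space set \<Rightarrow> ('e \<Rightarrow> 'b::real_normed_vector) \<Rightarrow> bool" where
  "Cr_on r S f \<longleftrightarrow> (\<forall>n. enat n \<le> r \<longrightarrow> Cn_on n S f)"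

section \<open>Manifolds\<close>

text \<open>
  A manifold is the set covered by the chart domains of a smooth atlas, with the topology induced
  by the atlas. A chart is a pair of its domain and its coordinate map; values of the coordinate
  map outside the domain are irrelevant. The model space is an arbitrary Euclidean space
  \<open>'e\<close>, so the dimension is \<open>DIM('e)\<close>, which is at least 1 for every
  type of this class. Atlases need not be maximal.
\<close>

type_synonym ('m, 'e) chart = "'m set \<times> ('m \<Rightarrow> 'e)"

definition chart_inv :: "('m, 'e) chart \<Rightarrow> 'e \<Rightarrow> 'm" where
  "chart_inv c = inv_into (fst c) (snd c)"

definition atlas_carrier :: "('m, 'e) chart set \<Rightarrow> 'm set" where
  "atlas_carrier A = (\<Union>c\<in>A. fst c)"

definition smooth_atlas :: "('m, 'e::euclidean_space) chart set \<Rightarrow> bool" where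
  "smooth_atlas A \<longleftrightarrow>
     (\<forall>c\<in>A. inj_on (snd c) (fst c)) \<and>
     (\<forall>c\<in>A. \<forall>c'\<in>A. open (snd c ` (fst c \<inter> fst c')) \<and>
        Cr_on \<infinity> (snd c ` (fst c \<inter> fst c')) (snd c' \<circ> chart_inv c))"

text \<open>
  The coarsest topology in which the chart domains are open and the coordinate maps continuous.
  For a smooth atlas it is the unique topology in which every chart is a homeomorphism from an
  open set onto its image.
\<close>

definition atlas_topology :: "('m, 'e::euclidean_space) chart set \<Rightarrow> 'm topology" where
  "atlas_topology A =
     topology_generated_by {{x \<in> fst c. snd c x \<in> V} | c V. c \<in> A \<and> open V}"

definition smooth_manifold :: "('m, 'e::euclidean_space) chart set \<Rightarrow> bool" where
  "smooth_manifold A \<longleftrightarrow> smooth_atlas A \<and>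
     Hausdorff_space (atlas_topology A) \<and> second_countable (atlas_topology A)"

definition closed_connected_manifold :: "('m, 'e::euclidean_space) chart set \<Rightarrow> bool" where
  "closed_connected_manifold A \<longleftrightarrow> smooth_manifold A \<and>
     compact_space (atlas_topology A) \<and> connected_space (atlas_topology A)"

definition Cr_fun_on ::
    "enat \<Rightarrow> ('m, 'e::euclidean_space) chart set \<Rightarrow> 'm set \<Rightarrow> ('m \<Rightarrow> 'b::real_normed_vector) \<Rightarrow> bool" where
  "Cr_fun_on r A W f \<longleftrightarrow> (\<forall>c\<in>A. Cr_on r (snd c ` (fst c \<inter> W)) (f \<circ> chart_inv c))"

section \<open>Riemannian metrics and rectifiable paths\<close>

text \<open>
  \<open>g x c u v\<close> is the value of the metric at the point \<open>x\<close> on the two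
  tangent vectors that have components \<open>u\<close> and \<open>v\<close> in the chart
  \<open>c\<close>.
\<close>

definition riemannian_metric ::
    "('m, 'e::euclidean_space) chart set \<Rightarrow> ('m \<Rightarrow> ('m, 'e) chart \<Rightarrow> 'e \<Rightarrow> 'e \<Rightarrow> real) \<Rightarrow> bool" where
  "riemannian_metric A g \<longleftrightarrow>
     (\<forall>c\<in>A. \<forall>x\<in>fst c. bilinear (g x c) \<and>
        (\<forall>u v. g x c u v = g x c v u) \<and> (\<forall>u. u \<noteq> 0 \<longrightarrow> g x c u u > 0)) \<and>
     (\<forall>c\<in>A. \<forall>c'\<in>A. \<forall>x\<in>fst c \<inter> fst c'. \<forall>u v.
        g x c u v = g x c' (frechet_derivative (snd c' \<circ> chart_inv c) (at (snd c x)) u)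
                           (frechet_derivative (snd c' \<circ> chart_inv c) (at (snd c x)) v)) \<and>
     (\<forall>c\<in>A. \<forall>u v. Cr_on \<infinity> (snd c ` fst c) (\<lambda>y. g (chart_inv c y) c u v))"

definition C1_curve_on ::
    "('m, 'e::euclidean_space) chart set \<Rightarrow> real set \<Rightarrow> (real \<Rightarrow> 'm) \<Rightarrow> bool" where
  "C1_curve_on A J \<gamma> \<longleftrightarrow> continuous_map (top_of_set J) (atlas_topology A) \<gamma> \<and>
     (\<forall>c\<in>A. \<exists>D. continuous_on {t \<in> J. \<gamma> t \<in> fst c} D \<and>
        (\<forall>t\<in>J. \<gamma> t \<in> fst c \<longrightarrow> ((snd c \<circ> \<gamma>) has_vector_derivative D t) (at t within J)))"

text \<open>
  The finite set \<open>S\<close> contains the break points: the curve is of class $C^1$, with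
  one-sided derivatives at the ends, on every closed subinterval without interior break points.
\<close>

definition piecewise_C1_curve ::
    "('m, 'e::euclidean_space) chart set \<Rightarrow> (real \<Rightarrow> 'm) \<Rightarrow> bool" where
  "piecewise_C1_curve A \<gamma> \<longleftrightarrow> pathin (atlas_topology A) \<gamma> \<and>
     (\<exists>S. finite S \<and> (\<forall>a b. 0 \<le> a \<and> a < b \<and> b \<le> 1 \<and> {a<..<b} \<inter> S = {} \<longrightarrow>
        C1_curve_on A {a..b} \<gamma>))"

text \<open>
  The speed does not depend on the chart selected at \<open>\<gamma> t\<close>. Its values at break
  points are irrelevant for the length.
\<close>

definition curve_speed ::
    "('m, 'e::euclidean_space) chart set \<Rightarrow> ('m \<Rightarrow> ('m, 'e) chart \<Rightarrow> 'e \<Rightarrow> 'e \<Rightarrow> real) \<Rightarrow>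
     (real \<Rightarrow> 'm) \<Rightarrow> real \<Rightarrow> real" where
  "curve_speed A g \<gamma> t =
     (let c = (SOME c. c \<in> A \<and> \<gamma> t \<in> fst c);
          v = vector_derivative (snd c \<circ> \<gamma>) (at t)
      in sqrt (g (\<gamma> t) c v v))"

definition riemannian_dist ::
    "('m, 'e::euclidean_space) chart set \<Rightarrow> ('m \<Rightarrow> ('m, 'e) chart \<Rightarrow> 'e \<Rightarrow> 'e \<Rightarrow> real) \<Rightarrow>
     'm \<Rightarrow> 'm \<Rightarrow> ennreal" where
  "riemannian_dist A g x y =
     (INF \<gamma> \<in> {\<gamma>. piecewise_C1_curve A \<gamma> \<and> \<gamma> 0 = x \<and> \<gamma> 1 = y}.
        ennreal (integral {0..1} (curve_speed A g \<gamma>)))"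

definition path_length ::
    "('m, 'e::euclidean_space) chart set \<Rightarrow> ('m \<Rightarrow> ('m, 'e) chart \<Rightarrow> 'e \<Rightarrow> 'e \<Rightarrow> real) \<Rightarrow>
     (real \<Rightarrow> 'm) \<Rightarrow> ennreal" where
  "path_length A g \<gamma> =
     (SUP (n, t) \<in> {(n::nat, t::nat \<Rightarrow> real). t 0 = 0 \<and> t n = 1 \<and> (\<forall>i<n. t i \<le> t (Suc i))}.
        \<Sum>i<n. riemannian_dist A g (\<gamma> (t i)) (\<gamma> (t (Suc i))))"

definition rectifiable_path_on ::
    "('m, 'e::euclidean_space) chart set \<Rightarrow> (real \<Rightarrow> 'm) \<Rightarrow> bool" where
  "rectifiable_path_on A \<gamma> \<longleftrightarrow> pathin (atlas_topology A) \<gamma> \<and>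
     (\<exists>g. riemannian_metric A g \<and> path_length A g \<gamma> < \<infinity>)"

section \<open>The cotangent bundle\<close>

text \<open>
  A covector at \<open>q\<close> is given by its components in all charts around \<open>q\<close>,
  subject to the transformation law
  $p_j = \sum_i p'_i \, \partial x'_i / \partial x_j$. The component vector
  \<open>\<xi> c\<close> represents the linear form \<open>v \<mapsto> \<xi> c \<bullet> v\<close> on
  tangent vectors with components \<open>v\<close>. For pairs of a point and a chart that is not a chart
  around it, the components are set to 0 to make the representation unique.
\<close>

type_synonym ('m, 'e) covec = "('m, 'e) chart \<Rightarrow> 'e"

definition covector_at ::
    "('m, 'e::euclidean_space) chart set \<Rightarrow> 'm \<Rightarrow> ('m, 'e) covec \<Rightarrow> bool" where
  "covector_at A q \<xi> \<longleftrightarrow>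
     (\<forall>c\<in>A. \<forall>c'\<in>A. q \<in> fst c \<inter> fst c' \<longrightarrow>
        (\<forall>v. \<xi> c \<bullet> v = \<xi> c' \<bullet> frechet_derivative (snd c' \<circ> chart_inv c) (at (snd c q)) v)) \<and>
     (\<forall>c. \<not> (c \<in> A \<and> q \<in> fst c) \<longrightarrow> \<xi> c = 0)"

definition cotangent_bundle ::
    "('m, 'e::euclidean_space) chart set \<Rightarrow> ('m \<times> ('m, 'e) covec) set" where
  "cotangent_bundle A = {(q, \<xi>). q \<in> atlas_carrier A \<and> covector_at A q \<xi>}"

text \<open>The canonical coordinates $(q,p)$ induced by a chart of the base.\<close>

definition cotangent_chart ::
    "('m, 'e::euclidean_space) chart set \<Rightarrow> ('m, 'e) chart \<Rightarrow>
     ('m \<times> ('m, 'e) covec, 'e \<times> 'e) chart" where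
  "cotangent_chart A c = ({x \<in> cotangent_bundle A. fst x \<in> fst c}, \<lambda>x. (snd c (fst x), snd x c))"

definition cotangent_atlas ::
    "('m, 'e::euclidean_space) chart set \<Rightarrow> ('m \<times> ('m, 'e) covec, 'e \<times> 'e) chart set" where
  "cotangent_atlas A = cotangent_chart A ` A"

definition lagrangian_graph_C1 ::
    "('m, 'e::euclidean_space) chart set \<Rightarrow> ('m \<times> ('m, 'e) covec) set \<Rightarrow> bool" where
  "lagrangian_graph_C1 A G \<longleftrightarrow> (\<exists>s.
     G = (\<lambda>q. (q, s q)) ` atlas_carrier A \<and>
     (\<forall>q\<in>atlas_carrier A. covector_at A q (s q)) \<and>
     (\<forall>c\<in>A. Cr_fun_on 1 A (fst c) (\<lambda>q. s q c)) \<and>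
     (\<forall>q0\<in>atlas_carrier A. \<exists>W S. openin (atlas_topology A) W \<and> q0 \<in> W \<and>
        Cr_fun_on 2 A W (S :: 'm \<Rightarrow> real) \<and>
        (\<forall>q\<in>W. \<forall>c\<in>A. q \<in> fst c \<longrightarrow>
           (\<forall>v. s q c \<bullet> v = frechet_derivative (S \<circ> chart_inv c) (at (snd c q)) v))))"

section \<open>Hamiltonian dynamics\<close>

text \<open>
  The vector field $(\partial H/\partial p, -\partial H/\partial q)$ in the canonical coordinates
  of the chart \<open>c\<close>, at the point with coordinates \<open>z = (q, p)\<close>.
\<close>

definition hamiltonian_field ::
    "('m, 'e::euclidean_space) chart set \<Rightarrow> ('m \<times> ('m, 'e) covec \<Rightarrow> real) \<Rightarrow> ('m, 'e) chart \<Rightarrow>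
     'e \<times> 'e \<Rightarrow> 'e \<times> 'e" where
  "hamiltonian_field A H c z =
     (let h' = frechet_derivative (H \<circ> chart_inv (cotangent_chart A c)) (at z)
      in (\<Sum>b\<in>Basis. h' (0, b) *\<^sub>R b, - (\<Sum>b\<in>Basis. h' (b, 0) *\<^sub>R b)))"

definition hamiltonian_integral_curve ::
    "('m, 'e::euclidean_space) chart set \<Rightarrow> ('m \<times> ('m, 'e) covec \<Rightarrow> real) \<Rightarrow> real set \<Rightarrow>
     (real \<Rightarrow> 'm \<times> ('m, 'e) covec) \<Rightarrow> bool" where
  "hamiltonian_integral_curve A H J \<gamma> \<longleftrightarrow>
     continuous_map (top_of_set J) (atlas_topology (cotangent_atlas A)) \<gamma> \<and>
     (\<forall>t\<in>J. \<forall>c\<in>A. fst (\<gamma> t) \<in> fst c \<longrightarrow>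
        ((snd (cotangent_chart A c) \<circ> \<gamma>) has_vector_derivative
           hamiltonian_field A H c (snd (cotangent_chart A c) (\<gamma> t))) (at t within J))"

text \<open>
  The graph of the time-\<open>t\<close> flow map. The map may be partial because the field need not be
  complete, and it is single-valued when \<open>H\<close> is of class $C^2$.
\<close>

definition hamiltonian_flow ::
    "('m, 'e::euclidean_space) chart set \<Rightarrow> ('m \<times> ('m, 'e) covec \<Rightarrow> real) \<Rightarrow> real \<Rightarrow>
     (('m \<times> ('m, 'e) covec) \<times> ('m \<times> ('m, 'e) covec)) set" where
  "hamiltonian_flow A H t = {(x, y). \<exists>\<gamma>.
     hamiltonian_integral_curve A H (closed_segment 0 t) \<gamma> \<and> \<gamma> 0 = x \<and> \<gamma> t = y}"

text \<open>
  Invariance for a Hamiltonian of class $C^r$. In the case \<open>2 \<le> r\<close>, the equality for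
  all \<open>t\<close>, including negative ones, forces the flow to be defined for all times on the set.
\<close>

definition hamiltonian_invariant ::
    "enat \<Rightarrow> ('m, 'e::euclidean_space) chart set \<Rightarrow> ('m \<times> ('m, 'e) covec \<Rightarrow> real) \<Rightarrow>
     ('m \<times> ('m, 'e) covec) set \<Rightarrow> bool" where
  "hamiltonian_invariant r A H L \<longleftrightarrow>
     (if 2 \<le> r then \<forall>t. hamiltonian_flow A H t `` L = L
      else \<forall>x\<in>L. \<exists>\<gamma>. hamiltonian_integral_curve A H UNIV \<gamma> \<and> x \<in> range \<gamma> \<and> range \<gamma> \<subseteq> L)"

end

theory Submission
  imports Defs
begin

text \<open>
  Write the graph as $p = s(q)$. Closedness of the 1-form makes $Ds$ symmetric, and an integral curve
  in the graph satisfies $\dot p = Ds\,\dot q$; hence the $C^1$ function $h(q) = H(q, s(q))$ has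
  vanishing derivative at the base points of \<open>\<Lambda>\<close>. Near such a point $h$ is therefore
  Lipschitz with arbitrarily small constant $\varepsilon$. Coordinate distance is locally bounded by a
  multiple of Riemannian distance, so along a rectifiable path of length $L$ in \<open>\<Lambda>\<close> the sum
  of the increments of \<open>H\<close> over a fine partition gives $|H(y) - H(x)| \le \varepsilon L$ for every
  $\varepsilon > 0$.
\<close>

section \<open>Symmetry of the second derivative\<close>

text \<open>Vanishing of the derivative of h at every point is not enough by itself: h is only C^1,
  and Whitney's example shows that a C^1 function can vary along a connected set of its critical
  points. Finite length closes this gap, because the small Lipschitz constants must be summed
  against something finite. Two features of the setting shape the rest. The length comes from some
  Riemannian metric on the cotangent bundle, and its distance is an infimum over curves that may
  leave any given chart; bounding it from below therefore needs an exit argument, and with it the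
  Hausdorff property of the bundle. The comparison constant depends on the point and on the metric,
  so the Lipschitz constant of h is divided by it locally, and compactness of the parameter interval
  makes the resulting estimate uniform. Since the graph is only C^1 and invariance may provide mere
  integral curves of a continuous field, all derivatives are taken at one point, and along the curve
  from one side only.\<close>

lemma second_difference_estimate:
  fixes f :: "'a::real_inner \<Rightarrow> real"
  assumes "open X" "q0 \<in> X" and f: "\<And>q. q \<in> X \<Longrightarrow> (f has_derivative (\<lambda>v. s q \<bullet> v)) (at q)"
    and s: "(s has_derivative s') (at q0)" and "0 < e"
  shows "\<exists>d>0. \<forall>t. 0 < t \<and> t < d \<longrightarrow>
    \<bar>f (q0 + t *\<^sub>R u + t *\<^sub>R v) - f (q0 + t *\<^sub>R u) - f (q0 + t *\<^sub>R v) + f q0 - t\<^sup>2 * (s' v \<bullet> u)\<bar> \<le> e * t\<^sup>2"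
proof -
  \<comment> \<open>Every point of the parallelogram spanned by \<open>t *\<^sub>R u\<close> and
    \<open>t *\<^sub>R v\<close> at \<open>q0\<close> is within \<open>t * K\<close> of
    \<open>q0\<close>; the summand 1 keeps \<open>K\<close> positive. In \<open>e'\<close>, the
    factor 2 pays for two Taylor remainders, one \<open>K\<close> for their size and the other for
    the inner product with \<open>u\<close>.\<close>
  define K where "K = norm u + norm v + 1"
  have K: "K > 0" "norm u \<le> K" "norm v \<le> K" by (simp_all add: K_def add_pos_nonneg add_nonneg_pos)
  define e' where "e' = e / (2 * K\<^sup>2)"
  have e': "e' > 0" using \<open>0 < e\<close> K by (simp add: e'_def)
  obtain d where d: "d > 0" "\<And>y. norm (y - q0) < d \<Longrightarrow> norm (s y - s q0 - s' (y - q0)) \<le> e' * norm (y - q0)"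
    using s e' unfolding has_derivative_at_alt by blast
  obtain r where r: "r > 0" "ball q0 r \<subseteq> X" using assms(1,2) open_contains_ball by blast
  have lin: "linear s'" using s has_derivative_linear by blast
  show ?thesis
  proof (intro exI[of _ "min d r / K"] conjI allI impI)
    show "0 < min d r / K" using d r K by simp
    fix t assume t: "0 < t \<and> t < min d r / K"
    then have tK: "t * K < d" "t * K < r" using K by (auto simp: field_simps)
    have near: "norm (\<xi> *\<^sub>R u + \<eta> *\<^sub>R v) \<le> t * K" if "0 \<le> \<xi>" "\<xi> \<le> t" "0 \<le> \<eta>" "\<eta> \<le> t" for \<xi> \<eta>
    proof -
      have "norm (\<xi> *\<^sub>R u + \<eta> *\<^sub>R v) \<le> \<xi> * norm u + \<eta> * norm v"
        using that norm_triangle_ineq[of "\<xi> *\<^sub>R u" "\<eta> *\<^sub>R v"] by simp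
      also have "\<dots> \<le> t * norm u + t * norm v"
        using that by (intro add_mono mult_right_mono) auto
      also have "\<dots> \<le> t * K" using t by (simp add: K_def algebra_simps)
      finally show ?thesis .
    qed
    have inX: "q0 + \<xi> *\<^sub>R u + \<eta> *\<^sub>R v \<in> X" if "0 \<le> \<xi>" "\<xi> \<le> t" "0 \<le> \<eta>" "\<eta> \<le> t" for \<xi> \<eta>
    proof -
      have "dist q0 (q0 + (\<xi> *\<^sub>R u + \<eta> *\<^sub>R v)) < r"
        using near[OF that] tK by (subst dist_commute) (simp add: dist_norm)
      then show ?thesis using r by (auto simp: add.assoc)
    qed
    have rem: "norm (s (q0 + \<xi> *\<^sub>R u + \<eta> *\<^sub>R v) - s q0 - s' (\<xi> *\<^sub>R u + \<eta> *\<^sub>R v)) \<le> e' * (t * K)"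
      if "0 \<le> \<xi>" "\<xi> \<le> t" "0 \<le> \<eta>" "\<eta> \<le> t" for \<xi> \<eta>
    proof -
      have "norm (s (q0 + \<xi> *\<^sub>R u + \<eta> *\<^sub>R v) - s q0 - s' (\<xi> *\<^sub>R u + \<eta> *\<^sub>R v))
         \<le> e' * norm (\<xi> *\<^sub>R u + \<eta> *\<^sub>R v)"
        using d(2)[of "q0 + (\<xi> *\<^sub>R u + \<eta> *\<^sub>R v)"] near[OF that] tK by (simp add: add.assoc)
      also have "\<dots> \<le> e' * (t * K)" using near[OF that] e' by (intro mult_left_mono) auto
      finally show ?thesis .
    qed
    \<comment> \<open>The increment of \<open>g\<close> over \<open>[0, t]\<close> is the second
      difference of \<open>f\<close>. The mean value theorem turns it into a difference of two
      gradients, so \<open>s\<close> has to be differentiable at \<open>q0\<close> only.\<close>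
    define g where "g \<xi> = f (q0 + \<xi> *\<^sub>R u + t *\<^sub>R v) - f (q0 + \<xi> *\<^sub>R u)" for \<xi>
    define g' where "g' \<xi> = (s (q0 + \<xi> *\<^sub>R u + t *\<^sub>R v) - s (q0 + \<xi> *\<^sub>R u)) \<bullet> u" for \<xi>
    have "(g has_real_derivative g' \<xi>) (at \<xi>)" if x: "0 \<le> \<xi>" "\<xi> \<le> t" for \<xi>
    proof -
      have "((\<lambda>\<xi>. f (q0 + \<xi> *\<^sub>R u + t *\<^sub>R v)) has_derivative (\<lambda>h. s (q0 + \<xi> *\<^sub>R u + t *\<^sub>R v) \<bullet> (h *\<^sub>R u))) (at \<xi>)"
        by (rule has_derivative_compose[where f = "\<lambda>\<xi>. q0 + \<xi> *\<^sub>R u + t *\<^sub>R v"])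
          (use f[OF inX[of \<xi> t]] x t in \<open>auto intro!: derivative_eq_intros\<close>)
      moreover have "((\<lambda>\<xi>. f (q0 + \<xi> *\<^sub>R u)) has_derivative (\<lambda>h. s (q0 + \<xi> *\<^sub>R u) \<bullet> (h *\<^sub>R u))) (at \<xi>)"
        by (rule has_derivative_compose[where f = "\<lambda>\<xi>. q0 + \<xi> *\<^sub>R u"])
          (use f[OF inX[of \<xi> 0]] x t in \<open>auto intro!: derivative_eq_intros\<close>)
      ultimately show ?thesis
        unfolding has_field_derivative_def g_def g'_def
        by (rule has_derivative_diff[THEN has_derivative_eq_rhs])
           (auto simp: fun_eq_iff algebra_simps)
    qed
    then obtain \<xi> where \<xi>: "0 < \<xi>" "\<xi> < t" "g t - g 0 = (t - 0) * g' \<xi>"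
      using MVT2[of 0 t g g'] t by auto
    \<comment> \<open>Both gradients are expanded at \<open>q0\<close>. The linear parts differ by
      exactly \<open>t *\<^sub>R s' v\<close>, whatever the intermediate point \<open>\<xi>\<close>
      is, and \<open>R\<close> collects the remainders.\<close>
    define R where "R = (s (q0 + \<xi> *\<^sub>R u + t *\<^sub>R v) - s q0 - s' (\<xi> *\<^sub>R u + t *\<^sub>R v))
       - (s (q0 + \<xi> *\<^sub>R u) - s q0 - s' (\<xi> *\<^sub>R u))"
    have nR: "norm R \<le> 2 * e' * (t * K)"
      using rem[of \<xi> t] rem[of \<xi> 0] \<xi> t unfolding R_def
      by (intro order_trans[OF norm_triangle_ineq4]) auto
    have "s (q0 + \<xi> *\<^sub>R u + t *\<^sub>R v) - s (q0 + \<xi> *\<^sub>R u) = t *\<^sub>R s' v + R"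
      by (simp add: R_def linear_add[OF lin] linear_scale[OF lin])
    then have "g t - g 0 - t\<^sup>2 * (s' v \<bullet> u) = t * (R \<bullet> u)"
      by (simp add: \<xi>(3) g'_def inner_add_left power2_eq_square algebra_simps)
    also have "\<bar>\<dots>\<bar> \<le> t * (2 * e' * (t * K) * K)"
      unfolding abs_mult using t K nR e'
      by (intro mult_mono order_trans[OF Cauchy_Schwarz_ineq2]) auto
    also have "\<dots> = e * t\<^sup>2" using K by (simp add: e'_def power2_eq_square)
    finally show "\<bar>f (q0 + t *\<^sub>R u + t *\<^sub>R v) - f (q0 + t *\<^sub>R u) - f (q0 + t *\<^sub>R v) + f q0 - t\<^sup>2 * (s' v \<bullet> u)\<bar> \<le> e * t\<^sup>2"
      by (simp add: g_def algebra_simps)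
  qed
qed

text \<open>The second difference of \<open>f\<close> does not change when \<open>u\<close> and
  \<open>v\<close> are swapped, while \<open>t\<^sup>2 * (s' v \<bullet> u)\<close> and
  \<open>t\<^sup>2 * (s' u \<bullet> v)\<close> both approximate it up to o(t^2). Applied to a local
  primitive of the 1-form, this is the symmetry of the derivative of a closed form.\<close>

lemma gradient_derivative_symmetric:
  fixes f :: "'a::real_inner \<Rightarrow> real"
  assumes "open X" "q0 \<in> X" and f: "\<And>q. q \<in> X \<Longrightarrow> (f has_derivative (\<lambda>v. s q \<bullet> v)) (at q)"
    and s: "(s has_derivative s') (at q0)"
  shows "s' u \<bullet> v = s' v \<bullet> u"
proof -
  have "\<bar>s' u \<bullet> v - s' v \<bullet> u\<bar> \<le> 0 + e" if e: "e > 0" for e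
  proof -
    define \<phi> where "\<phi> t = f (q0 + t *\<^sub>R u + t *\<^sub>R v) - f (q0 + t *\<^sub>R u) - f (q0 + t *\<^sub>R v) + f q0" for t
    obtain d1 where d1: "d1 > 0" "\<And>t. 0 < t \<Longrightarrow> t < d1 \<Longrightarrow> \<bar>\<phi> t - t\<^sup>2 * (s' v \<bullet> u)\<bar> \<le> e/2 * t\<^sup>2"
      using second_difference_estimate[OF assms half_gt_zero[OF e], of u v] unfolding \<phi>_def by blast
    have \<phi>_swap: "\<phi> t = f (q0 + t *\<^sub>R v + t *\<^sub>R u) - f (q0 + t *\<^sub>R v) - f (q0 + t *\<^sub>R u) + f q0" for t
      by (simp add: \<phi>_def add_ac)
    obtain d2 where d2: "d2 > 0" "\<And>t. 0 < t \<Longrightarrow> t < d2 \<Longrightarrow> \<bar>\<phi> t - t\<^sup>2 * (s' u \<bullet> v)\<bar> \<le> e/2 * t\<^sup>2"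
      using second_difference_estimate[OF assms half_gt_zero[OF e], of v u] unfolding \<phi>_swap by blast
    define t where "t = min d1 d2 / 2"
    have t: "0 < t" "t < d1" "t < d2" using d1 d2 by (auto simp: t_def)
    have "t\<^sup>2 * \<bar>s' u \<bullet> v - s' v \<bullet> u\<bar> = \<bar>t\<^sup>2 * (s' u \<bullet> v) - t\<^sup>2 * (s' v \<bullet> u)\<bar>"
      by (metis abs_mult abs_power2 right_diff_distrib)
    also have "\<dots> \<le> t\<^sup>2 * e" 
    proof -
      have "t\<^sup>2 * e = e/2 * t\<^sup>2 + e/2 * t\<^sup>2" by simp
      then show ?thesis using d1(2)[OF t(1,2)] d2(2)[OF t(1,3)] by linarith
    qed
    finally show ?thesis using t by simp
  qed
  then have "\<bar>s' u \<bullet> v - s' v \<bullet> u\<bar> \<le> 0" by (rule field_le_epsilon)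
  then show ?thesis by simp
qed

section \<open>Differentiable atlases\<close>

text \<open>Asks only for differentiable transition maps, so that the same facts about charts,
  curves and metrics serve the base manifold and its cotangent bundle; for the latter only this much
  regularity is established.\<close>

locale differentiable_atlas =
  fixes A :: "('m, 'e::euclidean_space) chart set"
  assumes chart_inj: "c \<in> A \<Longrightarrow> inj_on (snd c) (fst c)"
    and open_overlap: "c \<in> A \<Longrightarrow> c' \<in> A \<Longrightarrow> open (snd c ` (fst c \<inter> fst c'))"
    and transition_differentiable: "c \<in> A \<Longrightarrow> c' \<in> A \<Longrightarrow> x \<in> fst c \<inter> fst c' \<Longrightarrow>
      (snd c' \<circ> chart_inv c) differentiable (at (snd c x))"
begin

lemma chart_inv_chart [simp]: "c \<in> A \<Longrightarrow> x \<in> fst c \<Longrightarrow> chart_inv c (snd c x) = x"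
  by (simp add: chart_inv_def chart_inj)

lemma open_chart_image: "c \<in> A \<Longrightarrow> open (snd c ` fst c)"
  using open_overlap[of c c] by simp

lemma topspace_atlas: "topspace (atlas_topology A) = atlas_carrier A"
proof (intro set_eqI iffI)
  fix x assume "x \<in> topspace (atlas_topology A)"
  then show "x \<in> atlas_carrier A"
    unfolding atlas_topology_def atlas_carrier_def topology_generated_by_topspace by fast
next
  fix x assume "x \<in> atlas_carrier A"
  then obtain c where "c \<in> A" "x \<in> fst c" by (auto simp: atlas_carrier_def)
  then show "x \<in> topspace (atlas_topology A)"
    unfolding atlas_topology_def topology_generated_by_topspace
    by (intro UnionI[of "{x \<in> fst c. snd c x \<in> UNIV}"]) (blast intro: open_UNIV, simp)
qed

lemma openin_chart: "c \<in> A \<Longrightarrow> open V \<Longrightarrow> openin (atlas_topology A) {x \<in> fst c. snd c x \<in> V}"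
  unfolding atlas_topology_def by (rule topology_generated_by_Basis) blast

lemma openin_chart_domain: "c \<in> A \<Longrightarrow> openin (atlas_topology A) (fst c)"
  using openin_chart[of c UNIV] by simp

lemma openin_preimage_chart:
  assumes "continuous_map X (atlas_topology A) \<gamma>" "c \<in> A" "open V"
  shows "openin X {t \<in> topspace X. \<gamma> t \<in> fst c \<and> snd c (\<gamma> t) \<in> V}"
  using openin_continuous_map_preimage[OF assms(1) openin_chart[OF assms(2,3)]] by simp

lemma continuous_on_chart:
  assumes "continuous_map (top_of_set J) (atlas_topology A) \<gamma>" "c \<in> A" "I \<subseteq> J" "\<gamma> ` I \<subseteq> fst c"
  shows "continuous_on I (\<lambda>t. snd c (\<gamma> t))"
proof -
  have c: "continuous_map (top_of_set I) (atlas_topology A) \<gamma>"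
    by (rule continuous_map_from_subtopology_mono[OF assms(1,3)])
  have "continuous_map (top_of_set I) euclidean (\<lambda>t. snd c (\<gamma> t))"
    unfolding continuous_map
  proof (intro conjI allI impI)
    fix V :: "'e set" assume "openin euclidean V"
    then have V: "open V" by simp
    have eq: "{t \<in> topspace (top_of_set I). snd c (\<gamma> t) \<in> V}
       = {t \<in> topspace (top_of_set I). \<gamma> t \<in> fst c \<and> snd c (\<gamma> t) \<in> V}"
      using assms(4) unfolding topspace_euclidean_subtopology by blast
    show "openin (top_of_set I) {t \<in> topspace (top_of_set I). snd c (\<gamma> t) \<in> V}"
      unfolding eq by (rule openin_preimage_chart[OF c assms(2) V])
  qed simp
  then show ?thesis by (simp only: continuous_map_iff_continuous)
qed

text \<open>Continuity need only be tested on the generating sets of the topology. The preimage of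
  such a set is the preimage of a Euclidean open set under a transition map, which is continuous
  because it is differentiable.\<close>

lemma continuous_map_chart_inv:
  assumes c: "c \<in> A"
  shows "continuous_map (top_of_set (snd c ` fst c)) (atlas_topology A) (chart_inv c)"
  unfolding atlas_topology_def
proof (rule continuous_on_generated_topo)
  fix W assume "W \<in> {{x \<in> fst c. snd c x \<in> V} |c V. c \<in> A \<and> open V}"
  then obtain c' V where W: "W = {x \<in> fst c'. snd c' x \<in> V}" and c': "c' \<in> A" and V: "open V" by blast
  let ?O = "snd c ` (fst c \<inter> fst c')"
  have "continuous_on ?O (snd c' \<circ> chart_inv c)"
    using transition_differentiable[OF c c']
    by (intro continuous_at_imp_continuous_on) (auto intro: differentiable_imp_continuous_within)
  then have "open (?O \<inter> (snd c' \<circ> chart_inv c) -` V)"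
    using open_overlap[OF c c'] V continuous_open_preimage by blast
  moreover have "?O \<inter> (snd c' \<circ> chart_inv c) -` V = chart_inv c -` W \<inter> snd c ` fst c"
    using c by (auto simp: W image_iff)
  ultimately show "openin (top_of_set (snd c ` fst c)) (chart_inv c -` W \<inter> topspace (top_of_set (snd c ` fst c)))"
    by (simp add: open_openin_trans open_chart_image c inf.coboundedI2)
next
  show "chart_inv c ` topspace (top_of_set (snd c ` fst c)) \<subseteq> \<Union> {{x \<in> fst c. snd c x \<in> V} |c V. c \<in> A \<and> open V}"
    using c topspace_atlas unfolding atlas_topology_def atlas_carrier_def topology_generated_by_topspace by auto
qed

text \<open>Local primitives of the 1-form live on abstract open sets of the manifold; this makes
  their coordinate domains open, as differentiation requires.\<close>

lemma open_chart_image_openin: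
  assumes c: "c \<in> A" and W: "openin (atlas_topology A) W"
  shows "open (snd c ` (fst c \<inter> W))"
proof -
  have "openin (top_of_set (snd c ` fst c)) {z \<in> snd c ` fst c. chart_inv c z \<in> W}"
    using openin_continuous_map_preimage[OF continuous_map_chart_inv[OF c] W] by simp
  moreover have "{z \<in> snd c ` fst c. chart_inv c z \<in> W} = snd c ` (fst c \<inter> W)"
    using c by auto
  ultimately show ?thesis
    using open_chart_image[OF c] by (simp add: openin_open_eq)
qed

text \<open>Separation enters here: on a line with two origins, a compact coordinate interval around
  one origin is not closed, and a curve could leave it without crossing its end points.\<close>

lemma closedin_chart_inv_compact:
  assumes "Hausdorff_space (atlas_topology A)" and c: "c \<in> A" and K: "compact K" "K \<subseteq> snd c ` fst c"
  shows "closedin (atlas_topology A) (chart_inv c ` K)"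
proof -
  have "compactin (top_of_set (snd c ` fst c)) K" using K by (simp add: compactin_subtopology)
  then have "compactin (atlas_topology A) (chart_inv c ` K)"
    using image_compactin continuous_map_chart_inv[OF c] by blast
  then show ?thesis using compactin_imp_closedin assms(1) by blast
qed

lemma frechet_transition:
  assumes "c \<in> A" "c' \<in> A" "x \<in> fst c \<inter> fst c'"
  shows "((snd c' \<circ> chart_inv c) has_derivative frechet_derivative (snd c' \<circ> chart_inv c) (at (snd c x))) (at (snd c x))"
  using transition_differentiable[OF assms] frechet_derivative_works by blast

end

lemma Cr_on_1D:
  assumes "Cr_on r S f" "1 \<le> r"
  shows "x \<in> S \<Longrightarrow> f differentiable (at x)"
    and "continuous_on S (\<lambda>x. frechet_derivative f (at x) v)"
proof -
  have "Cn_on 1 S f" using assms unfolding Cr_on_def by (metis One_nat_def one_enat_def)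
  then show "x \<in> S \<Longrightarrow> f differentiable (at x)" "continuous_on S (\<lambda>x. frechet_derivative f (at x) v)"
    by (simp_all add: One_nat_def)
qed

lemma smooth_imp_differentiable_atlas:
  assumes "smooth_atlas A"
  shows "differentiable_atlas A"
proof
  fix c c' x assume *: "c \<in> A" "c' \<in> A" "x \<in> fst c \<inter> fst c'"
  then have "Cr_on \<infinity> (snd c ` (fst c \<inter> fst c')) (snd c' \<circ> chart_inv c)"
    using assms unfolding smooth_atlas_def by blast
  then show "(snd c' \<circ> chart_inv c) differentiable (at (snd c x))"
    by (rule Cr_on_1D) (use * in auto)
qed (use assms in \<open>auto simp: smooth_atlas_def\<close>)

section \<open>The atlas of the cotangent bundle\<close>

context differentiable_atlas
begin

abbreviation jac :: "('m, 'e) chart \<Rightarrow> ('m, 'e) chart \<Rightarrow> 'm \<Rightarrow> 'e \<Rightarrow> 'e" where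
  "jac c c' x \<equiv> frechet_derivative (snd c' \<circ> chart_inv c) (at (snd c x))"

text \<open>The chain rule at a point of a triple overlap. It makes the transformation law of
  covectors consistent.\<close>

lemma jac_cocycle:
  assumes c: "c \<in> A" "c' \<in> A" "c'' \<in> A" and x: "x \<in> fst c" "x \<in> fst c'" "x \<in> fst c''"
  shows "jac c c'' x v = jac c' c'' x (jac c c' x v)"
proof -
  have "((snd c'' \<circ> chart_inv c') \<circ> (snd c' \<circ> chart_inv c) has_derivative jac c' c'' x \<circ> jac c c' x) (at (snd c x))"
    using frechet_transition[of c c' x] frechet_transition[of c' c'' x] c x
    by (intro diff_chain_at) auto
  then have "((snd c'' \<circ> chart_inv c) has_derivative jac c' c'' x \<circ> jac c c' x) (at (snd c x))"
    by (rule has_derivative_transform_within_open[OF _ open_overlap[OF c(1,2)]]) (use c x in auto)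
  then have "jac c c'' x = jac c' c'' x \<circ> jac c c' x"
    using frechet_transition[of c c'' x] c x has_derivative_unique by blast
  then show ?thesis by simp
qed

lemma jac_refl:
  assumes c: "c \<in> A" "x \<in> fst c"
  shows "jac c c x v = v"
proof -
  have "((snd c \<circ> chart_inv c) has_derivative (\<lambda>v. v)) (at (snd c x))"
    by (rule has_derivative_transform_within_open[OF has_derivative_ident open_chart_image[OF c(1)]])
       (use c in auto)
  then have "jac c c x = (\<lambda>v. v)"
    using frechet_transition[of c c x] c has_derivative_unique by blast
  then show ?thesis by simp
qed

lemma linear_jac:
  assumes "c \<in> A" "c' \<in> A" "x \<in> fst c" "x \<in> fst c'"
  shows "linear (jac c c' x)"
  using frechet_transition[of c c' x] assms has_derivative_linear by blast

lemma covector_atD: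
  assumes "covector_at A q \<xi>" "c \<in> A" "c' \<in> A" "q \<in> fst c" "q \<in> fst c'"
  shows "\<xi> c \<bullet> v = \<xi> c' \<bullet> jac c c' q v"
proof -
  have "\<forall>c\<in>A. \<forall>c'\<in>A. q \<in> fst c \<inter> fst c' \<longrightarrow> (\<forall>v. \<xi> c \<bullet> v = \<xi> c' \<bullet> jac c c' q v)"
    using assms(1) unfolding covector_at_def by (rule conjunct1)
  then show ?thesis using assms(2-5) by blast
qed

lemma covector_unique:
  assumes "covector_at A q \<xi>" "covector_at A q \<eta>" "c \<in> A" "q \<in> fst c" "\<xi> c = \<eta> c"
  shows "\<xi> = \<eta>"
proof
  fix c' show "\<xi> c' = \<eta> c'"
  proof (cases "c' \<in> A \<and> q \<in> fst c'")
    case True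
    then have "\<xi> c' \<bullet> v = \<eta> c' \<bullet> v" for v
      using covector_atD[OF assms(1) _ assms(3)] covector_atD[OF assms(2) _ assms(3)] assms(4,5) by simp
    then show ?thesis using vector_eq_rdot by blast
  next
    case False
    then show ?thesis using assms unfolding covector_at_def by metis
  qed
qed

text \<open>The linear form with components \<open>p\<close> in \<open>c\<close> is pulled back to
  every other chart by the adjoint Jacobian, and the cocycle rule gives the transformation law. With
  \<open>covector_unique\<close> this identifies each fibre with the whole model space, which is why
  canonical charts are injective with open images.\<close>

lemma covector_exists:
  assumes c: "c \<in> A" "q \<in> fst c"
  shows "\<exists>\<xi>. covector_at A q \<xi> \<and> \<xi> c = p"
proof -
  define \<xi> where "\<xi> c' = (if c' \<in> A \<and> q \<in> fst c' then adjoint (jac c' c q) p else 0)" for c'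
  have \<xi>: "\<xi> c' \<bullet> v = p \<bullet> jac c' c q v" if "c' \<in> A" "q \<in> fst c'" for c' v
    using adjoint_works[OF linear_jac[of c' c q], of v p] that c by (simp add: \<xi>_def inner_commute)
  have "covector_at A q \<xi>"
    unfolding covector_at_def
  proof (intro conjI ballI impI allI)
    fix c' c'' v assume "c' \<in> A" "c'' \<in> A" "q \<in> fst c' \<inter> fst c''"
    then show "\<xi> c' \<bullet> v = \<xi> c'' \<bullet> jac c' c'' q v"
      using jac_cocycle[of c' c'' c q v] \<xi> c by simp
  qed (auto simp: \<xi>_def)
  moreover have "\<xi> c \<bullet> v = p \<bullet> v" for v using \<xi>[OF c] jac_refl[OF c] by simp
  then have "\<xi> c = p" using vector_eq_rdot by blast
  ultimately show ?thesis by blast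
qed

lemma fst_cotangent_chart: "x \<in> fst (cotangent_chart A c) \<longleftrightarrow> x \<in> cotangent_bundle A \<and> fst x \<in> fst c"
  by (simp add: cotangent_chart_def)

lemma snd_cotangent_chart: "snd (cotangent_chart A c) x = (snd c (fst x), snd x c)"
  by (simp add: cotangent_chart_def)

lemma cotangent_bundle_covector: "x \<in> cotangent_bundle A \<Longrightarrow> covector_at A (fst x) (snd x)"
  by (auto simp: cotangent_bundle_def)

lemma inj_cotangent_chart:
  assumes c: "c \<in> A"
  shows "inj_on (snd (cotangent_chart A c)) (fst (cotangent_chart A c))"
proof (rule inj_onI)
  fix x y assume x: "x \<in> fst (cotangent_chart A c)" and y: "y \<in> fst (cotangent_chart A c)"
    and eq: "snd (cotangent_chart A c) x = snd (cotangent_chart A c) y"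
  have "fst x = fst y"
    using inj_onD[OF chart_inj[OF c]] x y eq by (simp add: fst_cotangent_chart snd_cotangent_chart)
  moreover have "snd x = snd y"
    using x y eq c calculation cotangent_bundle_covector[of x] cotangent_bundle_covector[of y]
    by (intro covector_unique[of "fst x"]) (auto simp: fst_cotangent_chart snd_cotangent_chart)
  ultimately show "x = y" by (simp add: prod_eq_iff)
qed

lemma cotangent_chart_inv [simp]:
  "c \<in> A \<Longrightarrow> x \<in> fst (cotangent_chart A c) \<Longrightarrow> chart_inv (cotangent_chart A c) (snd (cotangent_chart A c) x) = x"
  by (simp add: chart_inv_def inj_cotangent_chart)

lemma cotangent_chart_image:
  assumes c: "c \<in> A"
  shows "snd (cotangent_chart A c) ` (fst (cotangent_chart A c) \<inter> fst (cotangent_chart A c'))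
    = (snd c ` (fst c \<inter> fst c')) \<times> UNIV"
proof (intro set_eqI iffI)
  fix z assume "z \<in> snd (cotangent_chart A c) ` (fst (cotangent_chart A c) \<inter> fst (cotangent_chart A c'))"
  then show "z \<in> (snd c ` (fst c \<inter> fst c')) \<times> UNIV"
    by (auto simp: fst_cotangent_chart snd_cotangent_chart)
next
  fix z assume "z \<in> (snd c ` (fst c \<inter> fst c')) \<times> (UNIV :: 'e set)"
  then obtain q where q: "q \<in> fst c" "q \<in> fst c'" "snd c q = fst z" by (auto simp: mem_Times_iff)
  obtain \<xi> where \<xi>: "covector_at A q \<xi>" "\<xi> c = snd z" using covector_exists[OF c q(1)] by blast
  have "q \<in> atlas_carrier A" using c q by (auto simp: atlas_carrier_def)
  then show "z \<in> snd (cotangent_chart A c) ` (fst (cotangent_chart A c) \<inter> fst (cotangent_chart A c'))"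
    using q \<xi> by (intro image_eqI[of _ _ "(q, \<xi>)"]) (auto simp: fst_cotangent_chart snd_cotangent_chart cotangent_bundle_def)
qed

lemma cotangent_chart_image_self:
  "c \<in> A \<Longrightarrow> snd (cotangent_chart A c) ` fst (cotangent_chart A c) = (snd c ` fst c) \<times> UNIV"
  using cotangent_chart_image[of c c] by simp

lemma atlas_carrier_cotangent: "atlas_carrier (cotangent_atlas A) = cotangent_bundle A"
proof (intro set_eqI iffI)
  fix x assume "x \<in> cotangent_bundle A"
  then obtain c where "c \<in> A" "x \<in> fst (cotangent_chart A c)"
    unfolding fst_cotangent_chart by (auto simp: cotangent_bundle_def atlas_carrier_def)
  then show "x \<in> atlas_carrier (cotangent_atlas A)"
    by (auto simp: atlas_carrier_def cotangent_atlas_def)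
qed (auto simp: atlas_carrier_def cotangent_atlas_def fst_cotangent_chart)

end

section \<open>Transition maps and topology of the cotangent bundle\<close>

lemma smooth_frechet_differentiable:
  assumes "Cr_on \<infinity> S f" "x \<in> S"
  shows "(\<lambda>x. frechet_derivative f (at x) v) differentiable (at x)"
proof -
  have "Cn_on (Suc (Suc 0)) S f" using assms(1) unfolding Cr_on_def by (metis enat_ord_simps(3))
  then show ?thesis using assms(2) by simp
qed

text \<open>In canonical coordinates the change of chart sends (q, p) to \<tau>(q) together with the
  transposed derivative of the reverse transition at \<tau>(q) applied to p. The fibre part thus
  contains a first derivative of a transition map, and its differentiability uses a second
  one.\<close>

lemma cotangent_transition_differentiable:
  fixes A :: "('m, 'e::euclidean_space) chart set"
  assumes A: "smooth_atlas A" and c: "c \<in> A" "c' \<in> A"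
    and x: "x \<in> fst (cotangent_chart A c) \<inter> fst (cotangent_chart A c')"
  shows "(snd (cotangent_chart A c') \<circ> chart_inv (cotangent_chart A c)) differentiable
    (at (snd (cotangent_chart A c) x))"
proof -
  interpret differentiable_atlas A using A by (rule smooth_imp_differentiable_atlas)
  define \<tau> where "\<tau> = snd c' \<circ> chart_inv c"
  define F where "F b y = frechet_derivative (snd c \<circ> chart_inv c') (at y) b" for b y
  define \<Phi> where "\<Phi> z = (\<tau> (fst z), \<Sum>b\<in>Basis. (snd z \<bullet> F b (\<tau> (fst z))) *\<^sub>R b)" for z :: "'e \<times> 'e"
  let ?O = "(snd c ` (fst c \<inter> fst c')) \<times> (UNIV :: 'e set)"
  let ?z = "snd (cotangent_chart A c) x"
  have x': "fst x \<in> fst c" "fst x \<in> fst c'" using x by (auto simp: fst_cotangent_chart)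
  have O: "open ?O" "?z \<in> ?O"
    using open_overlap[OF c] x' by (auto intro: open_Times simp: snd_cotangent_chart)
  have "\<tau> differentiable at (fst ?z)"
    using transition_differentiable[OF c, of "fst x"] x' by (simp add: \<tau>_def snd_cotangent_chart)
  moreover have fstd: "fst differentiable at ?z" "snd differentiable at ?z"
    by (auto intro: bounded_linear_imp_differentiable bounded_linear_fst bounded_linear_snd)
  ultimately have \<tau>: "(\<lambda>z. \<tau> (fst z)) differentiable at ?z"
    using differentiable_chain_at[of fst ?z \<tau>] by (simp add: o_def)
  have "F b differentiable at (\<tau> (fst ?z))" for b
  proof -
    have "\<tau> (fst ?z) \<in> snd c' ` (fst c' \<inter> fst c)"
      using c x' by (auto simp: \<tau>_def snd_cotangent_chart)
    moreover have "Cr_on \<infinity> (snd c' ` (fst c' \<inter> fst c)) (snd c \<circ> chart_inv c')"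
      using A c unfolding smooth_atlas_def by blast
    ultimately show ?thesis unfolding F_def by (intro smooth_frechet_differentiable)
  qed
  then have "(\<lambda>z. F b (\<tau> (fst z))) differentiable at ?z" for b
    using differentiable_chain_at[OF \<tau>, of "F b"] by (simp add: o_def)
  then have "\<Phi> differentiable at ?z"
    unfolding \<Phi>_def using \<tau> fstd
    by (intro differentiable_Pair differentiable_sum differentiable_scaleR differentiable_inner)
       (auto)
  then obtain D where D: "(\<Phi> has_derivative D) (at ?z)" by (auto simp: differentiable_def)
  have "\<Phi> z = (snd (cotangent_chart A c') \<circ> chart_inv (cotangent_chart A c)) z" if zO: "z \<in> ?O" for z
  proof -
    obtain y where y: "y \<in> fst (cotangent_chart A c)" "y \<in> fst (cotangent_chart A c')"
      "z = snd (cotangent_chart A c) y"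
      using zO unfolding cotangent_chart_image[OF c(1), of c', symmetric] by (elim imageE IntE)
    have \<tau>y: "\<tau> (snd c (fst y)) = snd c' (fst y)"
      using c y by (simp add: \<tau>_def fst_cotangent_chart)
    have z: "fst z = snd c (fst y)" "snd z = snd y c" using y(3) by (simp_all add: snd_cotangent_chart)
    have y': "y \<in> cotangent_bundle A" "fst y \<in> fst c'" "fst y \<in> fst c"
      using y(1,2) by (simp_all add: fst_cotangent_chart)
    \<comment> \<open>The transformation law is read from \<open>c'\<close> to \<open>c\<close>, so
      the components in \<open>c'\<close> appear as explicit functions of those in
      \<open>c\<close>.\<close>
    have comp: "snd y c' \<bullet> b = snd z \<bullet> F b (\<tau> (fst z))" for b
      unfolding F_def z \<tau>y by (rule covector_atD[OF cotangent_bundle_covector[OF y'(1)] c(2,1) y'(2,3)])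
    have "(\<Sum>b\<in>Basis. (snd z \<bullet> F b (\<tau> (fst z))) *\<^sub>R b) = snd y c'"
      unfolding comp[symmetric] by (rule euclidean_representation)
    then show ?thesis
      unfolding \<Phi>_def o_def y(3) cotangent_chart_inv[OF c(1) y(1)] by (simp add: snd_cotangent_chart \<tau>y)
  qed
  then show ?thesis
    using has_derivative_transform_within_open[OF D O] differentiable_def by metis
qed

lemma differentiable_cotangent_atlas:
  assumes A: "smooth_atlas A"
  shows "differentiable_atlas (cotangent_atlas A)"
proof -
  interpret differentiable_atlas A using A by (rule smooth_imp_differentiable_atlas)
  show ?thesis
  proof
    fix C assume "C \<in> cotangent_atlas A"
    then show "inj_on (snd C) (fst C)" by (auto simp: cotangent_atlas_def inj_cotangent_chart)
  next
    fix C C' assume "C \<in> cotangent_atlas A" "C' \<in> cotangent_atlas A"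
    then show "open (snd C ` (fst C \<inter> fst C'))"
      unfolding cotangent_atlas_def using open_overlap
      by (auto simp: cotangent_chart_image intro!: open_Times simp del: split_paired_All)
  next
    fix C C' x assume "C \<in> cotangent_atlas A" "C' \<in> cotangent_atlas A" "x \<in> fst C \<inter> fst C'"
    then show "(snd C' \<circ> chart_inv C) differentiable at (snd C x)"
      using cotangent_transition_differentiable[OF A] unfolding cotangent_atlas_def by blast
  qed
qed

lemma continuous_map_cotangent_projection:
  assumes A: "smooth_atlas A"
  shows "continuous_map (atlas_topology (cotangent_atlas A)) (atlas_topology A) fst"
proof -
  interpret differentiable_atlas A using A by (rule smooth_imp_differentiable_atlas)
  interpret T: differentiable_atlas "cotangent_atlas A" using A by (rule differentiable_cotangent_atlas)
  have top: "topspace (atlas_topology (cotangent_atlas A)) = cotangent_bundle A"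
    by (simp add: T.topspace_atlas atlas_carrier_cotangent)
  show ?thesis
    unfolding atlas_topology_def[of A]
  proof (rule continuous_on_generated_topo)
    fix U assume "U \<in> {{x \<in> fst c. snd c x \<in> V} |c V. c \<in> A \<and> open V}"
    then obtain c V where U: "U = {x \<in> fst c. snd c x \<in> V}" "c \<in> A" "open V" by blast
    have "openin (atlas_topology (cotangent_atlas A))
        {x \<in> fst (cotangent_chart A c). snd (cotangent_chart A c) x \<in> V \<times> UNIV}"
      using U by (intro T.openin_chart open_Times) (auto simp: cotangent_atlas_def)
    moreover have "{x \<in> fst (cotangent_chart A c). snd (cotangent_chart A c) x \<in> V \<times> UNIV}
        = fst -` U \<inter> cotangent_bundle A"
      by (auto simp: U fst_cotangent_chart snd_cotangent_chart)
    ultimately show "openin (atlas_topology (cotangent_atlas A)) (fst -` U \<inter> topspace (atlas_topology (cotangent_atlas A)))"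
      by (simp add: top)
  next
    show "fst ` topspace (atlas_topology (cotangent_atlas A)) \<subseteq> \<Union> {{x \<in> fst c. snd c x \<in> V} |c V. c \<in> A \<and> open V}"
      unfolding top topology_generated_by_topspace[symmetric] atlas_topology_def[symmetric] topspace_atlas
      by (auto simp: cotangent_bundle_def)
  qed
qed

text \<open>Points over different base points are separated by preimages under the projection.
  Points of one fibre lie in a common canonical chart, which is injective, and are separated by
  Euclidean open sets there.\<close>

lemma Hausdorff_cotangent:
  assumes A: "smooth_atlas A" and H: "Hausdorff_space (atlas_topology A)"
  shows "Hausdorff_space (atlas_topology (cotangent_atlas A))"
proof -
  interpret differentiable_atlas A using A by (rule smooth_imp_differentiable_atlas)
  interpret T: differentiable_atlas "cotangent_atlas A" using A by (rule differentiable_cotangent_atlas)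
  let ?T = "atlas_topology (cotangent_atlas A)"
  have top: "topspace ?T = cotangent_bundle A"
    by (simp add: T.topspace_atlas atlas_carrier_cotangent)
  note proj = continuous_map_cotangent_projection[OF A]
  show ?thesis
    unfolding Hausdorff_space_def
  proof (intro allI impI, elim conjE)
    fix x y assume x: "x \<in> topspace ?T" and y: "y \<in> topspace ?T" and ne: "x \<noteq> y"
    show "\<exists>U V. openin ?T U \<and> openin ?T V \<and> x \<in> U \<and> y \<in> V \<and> disjnt U V"
    proof (cases "fst x = fst y")
      case False
      have "fst x \<in> topspace (atlas_topology A)" "fst y \<in> topspace (atlas_topology A)"
        using x y proj by (auto simp: continuous_map_def Pi_iff)
      then obtain U V where UV: "openin (atlas_topology A) U" "openin (atlas_topology A) V"
        "fst x \<in> U" "fst y \<in> V" "disjnt U V"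
        using H False unfolding Hausdorff_space_def by metis
      then show ?thesis
        using openin_continuous_map_preimage[OF proj UV(1)] openin_continuous_map_preimage[OF proj UV(2)] x y
        by (intro exI[of _ "{x \<in> topspace ?T. fst x \<in> U}"] exI[of _ "{x \<in> topspace ?T. fst x \<in> V}"])
           (auto simp: disjnt_iff)
    next
      case True
      obtain c where c: "c \<in> A" "fst x \<in> fst c"
        using x unfolding top by (auto simp: cotangent_bundle_def atlas_carrier_def)
      let ?c = "cotangent_chart A c"
      have xy: "x \<in> fst ?c" "y \<in> fst ?c" using c x y True by (auto simp: fst_cotangent_chart top)
      have "snd ?c x \<noteq> snd ?c y" using inj_onD[OF inj_cotangent_chart[OF c(1)]] xy ne by blast
      then obtain U V where UV: "open U" "open V" "snd ?c x \<in> U" "snd ?c y \<in> V" "U \<inter> V = {}"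
        using hausdorff by metis
      have "?c \<in> cotangent_atlas A" using c by (auto simp: cotangent_atlas_def)
      then show ?thesis
        using T.openin_chart[OF _ UV(1), of ?c] T.openin_chart[OF _ UV(2), of ?c] UV(3-5) xy
        by (intro exI[of _ "{x \<in> fst ?c. snd ?c x \<in> U}"] exI[of _ "{x \<in> fst ?c. snd ?c x \<in> V}"])
           (auto simp: disjnt_iff)
    qed
  qed
qed

section \<open>Riemannian distance in charts\<close>

context differentiable_atlas
begin

lemma metricD:
  assumes "riemannian_metric A g" "c \<in> A" "x \<in> fst c"
  shows "bilinear (g x c)" and "u \<noteq> 0 \<Longrightarrow> g x c u u > 0" and "g x c u u \<ge> 0"
    and "c' \<in> A \<Longrightarrow> x \<in> fst c' \<Longrightarrow>
      g x c u v = g x c' (frechet_derivative (snd c' \<circ> chart_inv c) (at (snd c x)) u)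
                         (frechet_derivative (snd c' \<circ> chart_inv c) (at (snd c x)) v)"
proof -
  show b: "bilinear (g x c)" and p: "u \<noteq> 0 \<Longrightarrow> g x c u u > 0"
    using assms unfolding riemannian_metric_def by blast+
  show "g x c u u \<ge> 0" using p b by (cases "u = 0") (auto simp: bilinear_lzero)
  show "c' \<in> A \<Longrightarrow> x \<in> fst c' \<Longrightarrow>
      g x c u v = g x c' (frechet_derivative (snd c' \<circ> chart_inv c) (at (snd c x)) u)
                         (frechet_derivative (snd c' \<circ> chart_inv c) (at (snd c x)) v)"
    using assms unfolding riemannian_metric_def by blast
qed

text \<open>A metric is smooth in the point for fixed pairs of vectors. Expanding in the basis gives
  continuity when the vector varies as well.\<close>

lemma continuous_on_metric:
  assumes g: "riemannian_metric A g" and c: "c \<in> A"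
    and f: "continuous_on T f" "f ` T \<subseteq> snd c ` fst c" and v: "continuous_on T v"
  shows "continuous_on T (\<lambda>t. g (chart_inv c (f t)) c (v t) (v t))"
proof -
  have expand: "g (chart_inv c y) c w w = (\<Sum>(i, j)\<in>Basis \<times> Basis. (w \<bullet> i) * (w \<bullet> j) * g (chart_inv c y) c i j)"
    if "y \<in> snd c ` fst c" for y w
  proof -
    have b: "bilinear (g (chart_inv c y) c)" using metricD(1)[OF g c] that c by auto
    have "g (chart_inv c y) c w w = g (chart_inv c y) c (\<Sum>i\<in>Basis. (w \<bullet> i) *\<^sub>R i) (\<Sum>i\<in>Basis. (w \<bullet> i) *\<^sub>R i)"
      by (simp add: euclidean_representation)
    also have "\<dots> = (\<Sum>(i, j)\<in>Basis \<times> Basis. g (chart_inv c y) c ((w \<bullet> i) *\<^sub>R i) ((w \<bullet> j) *\<^sub>R j))"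
      using bilinear_sum[OF b] by blast
    also have "\<dots> = (\<Sum>(i, j)\<in>Basis \<times> Basis. (w \<bullet> i) * (w \<bullet> j) * g (chart_inv c y) c i j)"
      by (rule sum.cong) (auto simp: bilinear_lmul[OF b] bilinear_rmul[OF b])
    finally show ?thesis .
  qed
  have "continuous_on (snd c ` fst c) (\<lambda>y. g (chart_inv c y) c i j)" for i j
  proof -
    have "Cr_on \<infinity> (snd c ` fst c) (\<lambda>y. g (chart_inv c y) c i j)"
      using g c unfolding riemannian_metric_def by blast
    then have "Cn_on 0 (snd c ` fst c) (\<lambda>y. g (chart_inv c y) c i j)"
      unfolding Cr_on_def by (metis enat_ord_simps(3))
    then show ?thesis by simp
  qed
  then have "continuous_on T (\<lambda>t. g (chart_inv c (f t)) c i j)" for i j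
    using continuous_on_compose2 f by blast
  then have "continuous_on T (\<lambda>t. \<Sum>(i, j)\<in>Basis \<times> Basis. (v t \<bullet> i) * (v t \<bullet> j) * g (chart_inv c (f t)) c i j)"
    using v by (auto intro!: continuous_intros simp: case_prod_unfold)
  then show ?thesis
    by (rule continuous_on_eq) (use f expand in auto)
qed

text \<open>On the compact product of \<open>K\<close> with the unit sphere the quadratic form
  attains a positive minimum; homogeneity extends the bound to all vectors, with \<open>m\<close>
  the square root of the minimum. An empty \<open>K\<close> has no minimum and is treated
  apart.\<close>

lemma metric_lower_bound:
  assumes g: "riemannian_metric A g" and c: "c \<in> A" and K: "compact K" "K \<subseteq> snd c ` fst c"
  obtains m where "m > 0" "\<And>x v. x \<in> fst c \<Longrightarrow> snd c x \<in> K \<Longrightarrow> m * norm v \<le> sqrt (g x c v v)"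
proof (cases "K = {}")
  case True
  then show ?thesis using that[of 1] by simp
next
  case False
  let ?S = "K \<times> sphere (0 :: 'e) 1"
  let ?h = "\<lambda>(y, v). g (chart_inv c y) c v v"
  have "continuous_on ?S (\<lambda>p. g (chart_inv c (fst p)) c (snd p) (snd p))"
    using K by (intro continuous_on_metric[OF g c]) (auto intro!: continuous_intros)
  then have "continuous_on ?S ?h" by (simp add: case_prod_unfold)
  moreover have "compact ?S" using K by (intro compact_Times) auto
  moreover have "?S \<noteq> {}" using False by auto
  ultimately obtain p where p: "p \<in> ?S" "\<And>q. q \<in> ?S \<Longrightarrow> ?h p \<le> ?h q"
    using continuous_attains_inf[of ?S ?h] by blast
  define \<mu> where "\<mu> = ?h p"
  have "chart_inv c (fst p) \<in> fst c" "snd p \<noteq> 0" using p(1) K c by auto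
  then have "\<mu> > 0" using metricD(2)[OF g c] by (simp add: \<mu>_def case_prod_unfold)
  have "sqrt \<mu> * norm v \<le> sqrt (g x c v v)" if x: "x \<in> fst c" "snd c x \<in> K" for x v
  proof (cases "v = 0")
    case True
    then show ?thesis using metricD(3)[OF g c x(1)] by simp
  next
    case False
    have b: "bilinear (g x c)" using metricD(1)[OF g c x(1)] .
    have "\<mu> \<le> ?h (snd c x, (1 / norm v) *\<^sub>R v)"
      unfolding \<mu>_def using x False by (intro p(2)) auto
    also have "\<dots> = g x c v v / (norm v)\<^sup>2"
      using c x by (simp add: bilinear_lmul[OF b] bilinear_rmul[OF b] power2_eq_square)
    finally have "\<mu> * (norm v)\<^sup>2 \<le> g x c v v" using False by (simp add: field_simps)
    then show ?thesis using real_sqrt_le_mono by (fastforce simp: real_sqrt_mult)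
  qed
  then show ?thesis using that[of "sqrt \<mu>"] \<open>\<mu> > 0\<close> by simp
qed

section \<open>Speed and length of piecewise C^1 curves\<close>

lemma curve_speed_eq:
  assumes g: "riemannian_metric A g" and c: "c \<in> A"
    and I: "open I" "t \<in> I" "\<sigma> ` I \<subseteq> fst c"
    and v: "((snd c \<circ> \<sigma>) has_vector_derivative v) (at t)"
  shows "curve_speed A g \<sigma> t = sqrt (g (\<sigma> t) c v v)"
proof -
  \<comment> \<open>\<open>c1\<close> is the chart that \<open>curve_speed\<close> happens to
    select. The velocities in \<open>c\<close> and \<open>c1\<close> correspond under the Jacobian,
    and the transformation law of the metric makes the two speeds equal.\<close>
  define c1 where "c1 = (SOME c. c \<in> A \<and> \<sigma> t \<in> fst c)"
  have "c1 \<in> A \<and> \<sigma> t \<in> fst c1"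
    unfolding c1_def using c I by (intro someI[of "\<lambda>c. c \<in> A \<and> \<sigma> t \<in> fst c" c]) auto
  then have c1: "c1 \<in> A" "\<sigma> t \<in> fst c1" by auto
  have ct: "\<sigma> t \<in> fst c" using I by auto
  let ?J = "frechet_derivative (snd c1 \<circ> chart_inv c) (at (snd c (\<sigma> t)))"
  have J: "((snd c1 \<circ> chart_inv c) has_derivative ?J) (at ((snd c \<circ> \<sigma>) t))"
    using frechet_transition[OF c c1(1)] c1 ct by simp
  have "(((snd c1 \<circ> chart_inv c) \<circ> (snd c \<circ> \<sigma>)) has_vector_derivative ?J v) (at t)"
    by (rule vector_derivative_diff_chain_within[OF v has_derivative_at_withinI[OF J]])
  then have "((snd c1 \<circ> \<sigma>) has_vector_derivative ?J v) (at t)"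
    by (rule has_vector_derivative_transform_within_open[OF _ I(1,2)]) (use I c in auto)
  then have "vector_derivative (snd c1 \<circ> \<sigma>) (at t) = ?J v"
    by (rule vector_derivative_at)
  then have "curve_speed A g \<sigma> t = sqrt (g (\<sigma> t) c1 (?J v) (?J v))"
    by (simp add: curve_speed_def Let_def flip: c1_def)
  then show ?thesis using metricD(4)[OF g c ct c1] by simp
qed

lemma curve_speed_nonneg:
  assumes g: "riemannian_metric A g" and "\<sigma> t \<in> atlas_carrier A"
  shows "curve_speed A g \<sigma> t \<ge> 0"
proof -
  define c1 where "c1 = (SOME c. c \<in> A \<and> \<sigma> t \<in> fst c)"
  have "c1 \<in> A \<and> \<sigma> t \<in> fst c1"
    unfolding c1_def by (rule someI_ex) (use assms(2) in \<open>simp only: atlas_carrier_def UN_iff Bex_def\<close>)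
  then have "0 \<le> g (\<sigma> t) c1 v v" for v using metricD(3)[OF g] by blast
  then show ?thesis by (simp add: curve_speed_def Let_def flip: c1_def)
qed

lemma C1_curve_interior:
  assumes C: "C1_curve_on A {a..b} \<sigma>" and t: "a < t" "t < b" and c: "c \<in> A" "\<sigma> t \<in> fst c"
  obtains I where "open I" "t \<in> I" "I \<subseteq> {a<..<b}" "\<sigma> ` I \<subseteq> fst c"
proof -
  have "openin (top_of_set {a..b}) {s \<in> topspace (top_of_set {a..b}). \<sigma> s \<in> fst c}"
    using C openin_continuous_map_preimage openin_chart_domain[OF c(1)] unfolding C1_curve_on_def by blast
  then obtain T where T: "open T" "{s \<in> {a..b}. \<sigma> s \<in> fst c} = {a..b} \<inter> T"
    by (auto simp: openin_open)
  show ?thesis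
  proof (rule that[of "T \<inter> {a<..<b}"])
    show "open (T \<inter> {a<..<b})" using T by auto
    have "t \<in> {a..b} \<inter> T" unfolding T(2)[symmetric] using t c by simp
    then show "t \<in> T \<inter> {a<..<b}" using t by simp
    show "\<sigma> ` (T \<inter> {a<..<b}) \<subseteq> fst c"
    proof (rule image_subsetI)
      fix s assume "s \<in> T \<inter> {a<..<b}"
      then have "s \<in> {a..b} \<inter> T" by auto
      then show "\<sigma> s \<in> fst c" unfolding T(2)[symmetric] by simp
    qed
  qed auto
qed

text \<open>Inside one chart the speed agrees with a continuous function built from the one-sided
  derivatives \<open>D\<close>. The end points are exempted, since the two-sided derivative in
  \<open>curve_speed\<close> need not exist there. The hypothesis on the curve is conditional so
  that degenerate intervals are covered too.\<close>

lemma curve_speed_integrable_chart: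
  assumes g: "riemannian_metric A g" and c: "c \<in> A"
    and C: "a < b \<Longrightarrow> C1_curve_on A {a..b} \<sigma>" and \<sigma>: "\<sigma> ` {a..b} \<subseteq> fst c"
  shows "curve_speed A g \<sigma> integrable_on {a..b}"
proof (cases "a < b")
  case True
  have eq: "{t \<in> {a..b}. \<sigma> t \<in> fst c} = {a..b}" using \<sigma> by auto
  obtain D where D: "continuous_on {a..b} D"
    "\<And>t. t \<in> {a..b} \<Longrightarrow> ((snd c \<circ> \<sigma>) has_vector_derivative D t) (at t within {a..b})"
  proof -
    obtain D where "continuous_on {t \<in> {a..b}. \<sigma> t \<in> fst c} D"
      "\<forall>t\<in>{a..b}. \<sigma> t \<in> fst c \<longrightarrow> ((snd c \<circ> \<sigma>) has_vector_derivative D t) (at t within {a..b})"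
      using C[OF True] c unfolding C1_curve_on_def by blast
    then show ?thesis using \<sigma> unfolding eq by (intro that[of D]) (auto simp: image_subset_iff)
  qed
  have cont: "continuous_on {a..b} (\<lambda>t. snd c (\<sigma> t))"
    using C[OF True] c \<sigma> unfolding C1_curve_on_def by (blast intro: continuous_on_chart)
  have "continuous_on {a..b} (\<lambda>t. sqrt (g (chart_inv c (snd c (\<sigma> t))) c (D t) (D t)))"
    using \<sigma> by (intro continuous_on_real_sqrt continuous_on_metric[OF g c cont] D) auto
  then have int: "(\<lambda>t. sqrt (g (chart_inv c (snd c (\<sigma> t))) c (D t) (D t))) integrable_on {a..b}"
    by (rule integrable_continuous_real)
  have eq: "curve_speed A g \<sigma> t = sqrt (g (chart_inv c (snd c (\<sigma> t))) c (D t) (D t))"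
    if "t \<in> {a..b} - {a, b}" for t
  proof -
    have t: "a < t" "t < b" using that by auto
    have \<sigma>t: "\<sigma> t \<in> fst c" using \<sigma> t by auto
    obtain I where "open I" "t \<in> I" "I \<subseteq> {a<..<b}" "\<sigma> ` I \<subseteq> fst c"
      using C1_curve_interior[OF C[OF True] t c \<sigma>t] .
    moreover have "((snd c \<circ> \<sigma>) has_vector_derivative D t) (at t)"
      using D(2)[of t] t by (simp add: at_within_Icc_at)
    ultimately show ?thesis using curve_speed_eq[OF g c] \<sigma>t c by simp
  qed
  show ?thesis by (rule integrable_spike_finite[of "{a, b}", OF _ eq int]) auto
next
  case False
  then have "measure lborel (cbox a b) = 0" by simp
  then show ?thesis using integrable_on_null by fastforce
qed

text \<open>The integral of a non-integrable function is 0 by convention, so a lower bound for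
  lengths has to rule this case out. Integrability near every parameter is enough on a compact
  interval.\<close>

lemma curve_speed_integrable:
  assumes g: "riemannian_metric A g" and \<sigma>: "piecewise_C1_curve A \<sigma>"
  shows "curve_speed A g \<sigma> integrable_on {0..1}"
proof -
  have p: "continuous_map (top_of_set {0..1}) (atlas_topology A) \<sigma>"
    using \<sigma> by (simp add: piecewise_C1_curve_def pathin_def)
  obtain S where S: "finite S"
    "\<And>a b. 0 \<le> a \<Longrightarrow> a < b \<Longrightarrow> b \<le> 1 \<Longrightarrow> {a<..<b} \<inter> S = {} \<Longrightarrow> C1_curve_on A {a..b} \<sigma>"
    using \<sigma> unfolding piecewise_C1_curve_def by blast
  have "curve_speed A g \<sigma> integrable_on cbox 0 1"
  proof (rule integrable_on_little_subintervals, intro ballI)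
    fix t :: real assume "t \<in> cbox 0 1"
    then have t: "t \<in> {0..1}" by simp
    then have "\<sigma> t \<in> atlas_carrier A"
      using p by (auto simp: continuous_map_def topspace_atlas Pi_iff)
    then obtain c where c: "c \<in> A" "\<sigma> t \<in> fst c" by (auto simp: atlas_carrier_def)
    have "openin (top_of_set {0..1}) {s \<in> topspace (top_of_set {0..1}). \<sigma> s \<in> fst c}"
      using p openin_continuous_map_preimage openin_chart_domain[OF c(1)] by blast
    then obtain T where T: "open T" "{s \<in> {0..1}. \<sigma> s \<in> fst c} = {0..1} \<inter> T"
      by (auto simp: openin_open)
    \<comment> \<open>Near \<open>t\<close> the curve stays in one chart and has no break point
      except possibly \<open>t\<close> itself; small intervals around \<open>t\<close> are therefore
      split at \<open>t\<close>.\<close>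
    have "open (T - (S - {t}))" "t \<in> T - (S - {t})"
      using T t c S(1) by (auto intro: open_Diff finite_imp_closed)
    then obtain d where d: "d > 0" "ball t d \<subseteq> T - (S - {t})"
      using open_contains_ball by meson
    show "\<exists>d>0. \<forall>u v. t \<in> cbox u v \<and> cbox u v \<subseteq> ball t d \<and> cbox u v \<subseteq> cbox 0 1 \<longrightarrow>
        curve_speed A g \<sigma> integrable_on cbox u v"
    proof (intro exI[of _ d] conjI allI impI d, elim conjE)
      fix u v assume uv: "t \<in> cbox u v" "cbox u v \<subseteq> ball t d" "cbox u v \<subseteq> cbox 0 1"
      then have uv': "u \<le> t" "t \<le> v" "0 \<le> u" "v \<le> 1" by auto
      have sub: "{u..v} \<subseteq> {s \<in> {0..1}. \<sigma> s \<in> fst c}" "{u..v} \<inter> S \<subseteq> {t}"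
        using uv d(2) unfolding T(2) by auto
      have uniq: "s = t" if "s \<in> S" "u \<le> s" "s \<le> v" for s using sub(2) that by auto
      have "{u<..<t} \<inter> S = {}"
      proof (rule equals0I)
        fix s assume "s \<in> {u<..<t} \<inter> S"
        then show False using uniq[of s] uv' by simp
      qed
      moreover have "{t<..<v} \<inter> S = {}"
      proof (rule equals0I)
        fix s assume "s \<in> {t<..<v} \<inter> S"
        then show False using uniq[of s] uv' by simp
      qed
      moreover have "\<sigma> ` {u..t} \<subseteq> fst c" using sub(1) uv'(1,2) by (auto simp: subset_iff)
      moreover have "\<sigma> ` {t..v} \<subseteq> fst c" using sub(1) uv'(1,2) by (auto simp: subset_iff)
      ultimately have "curve_speed A g \<sigma> integrable_on {u..t}" "curve_speed A g \<sigma> integrable_on {t..v}"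
        using uv' by (auto intro!: curve_speed_integrable_chart[OF g c(1)] S(2))
      then show "curve_speed A g \<sigma> integrable_on cbox u v"
        using uv' Henstock_Kurzweil_Integration.integrable_combine[of u t v] by simp
    qed
  qed
  then show ?thesis by simp
qed

text \<open>The coordinate displacement up to \<open>\<tau>\<close> is the integral of the
  coordinate velocity, whose norm is at most the speed divided by \<open>m\<close>. Stopping at
  \<open>\<tau>\<close> leaves the curve free to leave the chart afterwards; the remaining speed is
  nonnegative.\<close>

lemma chart_displacement_le_length:
  assumes g: "riemannian_metric A g" and \<sigma>: "piecewise_C1_curve A \<sigma>"
    and c: "c \<in> A" and \<tau>: "0 \<le> \<tau>" "\<tau> \<le> 1" and K: "\<And>t. 0 \<le> t \<Longrightarrow> t \<le> \<tau> \<Longrightarrow> \<sigma> t \<in> fst c \<and> snd c (\<sigma> t) \<in> K"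
    and m: "m > 0" "\<And>x v. x \<in> fst c \<Longrightarrow> snd c x \<in> K \<Longrightarrow> m * norm v \<le> sqrt (g x c v v)"
  shows "m * norm (snd c (\<sigma> \<tau>) - snd c (\<sigma> 0)) \<le> integral {0..1} (curve_speed A g \<sigma>)"
proof -
  have p: "continuous_map (top_of_set {0..1}) (atlas_topology A) \<sigma>"
    using \<sigma> by (simp add: piecewise_C1_curve_def pathin_def)
  obtain S where S: "finite S"
    "\<And>a b. 0 \<le> a \<Longrightarrow> a < b \<Longrightarrow> b \<le> 1 \<Longrightarrow> {a<..<b} \<inter> S = {} \<Longrightarrow> C1_curve_on A {a..b} \<sigma>"
    using \<sigma> unfolding piecewise_C1_curve_def by blast
  \<comment> \<open>The value 0 at break points and at the ends makes the norm bound trivial there;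
    the fundamental theorem tolerates these finitely many exceptions.\<close>
  define f' where "f' t = (if t \<in> {0<..<\<tau>} - S then vector_derivative (snd c \<circ> \<sigma>) (at t) else 0)" for t
  have nonneg: "curve_speed A g \<sigma> t \<ge> 0" if "t \<in> {0..1}" for t
    using that p by (intro curve_speed_nonneg[OF g]) (auto simp: continuous_map_def topspace_atlas Pi_iff)
  have deriv: "((snd c \<circ> \<sigma>) has_vector_derivative f' t) (at t) \<and> m * norm (f' t) \<le> curve_speed A g \<sigma> t"
    if t: "t \<in> {0<..<\<tau>} - S" for t
  proof -
    have "open ({0<..<\<tau>} - S)" using S(1) by (auto intro: open_Diff finite_imp_closed)
    then obtain d where d: "d > 0" "ball t d \<subseteq> {0<..<\<tau>} - S"
      using t open_contains_ball by meson
    define a b where "a = t - d/2" and "b = t + d/2"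
    have ab: "a < t" "t < b" "{a..b} \<subseteq> {0<..<\<tau>} - S"
      using d by (auto simp: a_def b_def dist_real_def subset_iff)
    then have "a \<in> {0<..<\<tau>}" "b \<in> {0<..<\<tau>}" by (auto simp: subset_iff)
    then have C: "C1_curve_on A {a..b} \<sigma>"
      using ab \<tau> by (intro S(2)) (auto simp: subset_iff)
    have \<sigma>t: "\<sigma> t \<in> fst c" "snd c (\<sigma> t) \<in> K" using K[of t] t by auto
    obtain D where D: "\<forall>t\<in>{a..b}. \<sigma> t \<in> fst c \<longrightarrow> ((snd c \<circ> \<sigma>) has_vector_derivative D t) (at t within {a..b})"
      using C c unfolding C1_curve_on_def by blast
    define v where "v = D t"
    have "((snd c \<circ> \<sigma>) has_vector_derivative v) (at t within {a..b})"
      using D \<sigma>t ab(1,2) by (simp add: v_def)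
    then have v: "((snd c \<circ> \<sigma>) has_vector_derivative v) (at t)"
      using ab by (simp add: at_within_Icc_at)
    then have f': "f' t = v" using t by (simp add: f'_def vector_derivative_at)
    obtain I where I: "open I" "t \<in> I" "I \<subseteq> {a<..<b}" "\<sigma> ` I \<subseteq> fst c"
      using C1_curve_interior[OF C ab(1,2) c \<sigma>t(1)] .
    have "curve_speed A g \<sigma> t = sqrt (g (\<sigma> t) c v v)" by (rule curve_speed_eq[OF g c I(1,2,4) v])
    then show ?thesis using v f' m(2)[OF \<sigma>t] by simp
  qed
  have cont: "continuous_on {0..\<tau>} (snd c \<circ> \<sigma>)"
    unfolding o_def using K \<tau> by (intro continuous_on_chart[OF p c]) auto
  have I: "(f' has_integral ((snd c \<circ> \<sigma>) \<tau> - (snd c \<circ> \<sigma>) 0)) {0..\<tau>}"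
    by (rule fundamental_theorem_of_calculus_interior_strong[OF S(1) \<tau>(1) _ cont]) (rule conjunct1[OF deriv])
  have int: "curve_speed A g \<sigma> integrable_on {0..1}" by (rule curve_speed_integrable[OF g \<sigma>])
  have int\<tau>: "curve_speed A g \<sigma> integrable_on {0..\<tau>}"
    by (rule integrable_subinterval_real[OF int]) (use \<tau> in auto)
  have "norm (integral {0..\<tau>} f') \<le> integral {0..\<tau>} (\<lambda>t. curve_speed A g \<sigma> t / m)"
  proof (rule integral_norm_bound_integral)
    show "f' integrable_on {0..\<tau>}" using I by blast
    show "(\<lambda>t. curve_speed A g \<sigma> t / m) integrable_on {0..\<tau>}"
      using int\<tau> by (rule integrable_on_divide)
    show "norm (f' t) \<le> curve_speed A g \<sigma> t / m" if "t \<in> {0..\<tau>}" for t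
    proof (cases "t \<in> {0<..<\<tau>} - S")
      case True
      then show ?thesis using deriv[OF True] m(1) by (simp add: field_simps)
    next
      case False
      then have "f' t = 0" unfolding f'_def by (rule if_not_P)
      then show ?thesis using nonneg[of t] that \<tau> m(1) by simp
    qed
  qed
  then have "m * norm (snd c (\<sigma> \<tau>) - snd c (\<sigma> 0)) \<le> integral {0..\<tau>} (curve_speed A g \<sigma>)"
    using I m(1) by (simp add: integral_unique field_simps)
  also have "\<dots> \<le> integral {0..1} (curve_speed A g \<sigma>)"
    using int int\<tau> nonneg \<tau> by (intro integral_subset_le) auto
  finally show ?thesis .
qed

text \<open>A curve that leaves the closed ball of radius \<open>2 * r\<close> has at its first exit time covered a
  coordinate distance of at least \<open>r\<close>. The Hausdorff property ensures that it can leave only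
  through the boundary sphere.\<close>

lemma chart_dist_le_riemannian_dist:
  assumes H: "Hausdorff_space (atlas_topology A)" and g: "riemannian_metric A g" and c: "c \<in> A"
    and r: "r > 0" "cball z (2 * r) \<subseteq> snd c ` fst c"
    and m: "m > 0" "\<And>x v. x \<in> fst c \<Longrightarrow> snd c x \<in> cball z (2 * r) \<Longrightarrow> m * norm v \<le> sqrt (g x c v v)"
    and x: "x \<in> fst c" "snd c x \<in> ball z r" and y: "y \<in> fst c" "snd c y \<in> ball z r"
  shows "ennreal (m / 2 * norm (snd c x - snd c y)) \<le> riemannian_dist A g x y"
  unfolding riemannian_dist_def
proof (rule INF_greatest, clarify)
  fix \<sigma> assume \<sigma>: "piecewise_C1_curve A \<sigma>" and xy: "x = \<sigma> 0" "y = \<sigma> 1"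
  have p: "continuous_map (top_of_set {0..1}) (atlas_topology A) \<sigma>"
    using \<sigma> by (simp add: piecewise_C1_curve_def pathin_def)
  let ?K = "chart_inv c ` cball z (2 * r)"
  have inK: "\<sigma> t \<in> ?K \<longleftrightarrow> \<sigma> t \<in> fst c \<and> snd c (\<sigma> t) \<in> cball z (2 * r)" for t
  proof
    assume "\<sigma> t \<in> ?K"
    then obtain w where w: "w \<in> cball z (2 * r)" "\<sigma> t = chart_inv c w" by blast
    then obtain x where "x \<in> fst c" "w = snd c x" using r(2) by blast
    then show "\<sigma> t \<in> fst c \<and> snd c (\<sigma> t) \<in> cball z (2 * r)" using w c by simp
  next
    assume "\<sigma> t \<in> fst c \<and> snd c (\<sigma> t) \<in> cball z (2 * r)"
    then show "\<sigma> t \<in> ?K" using c by (intro image_eqI[of _ _ "snd c (\<sigma> t)"]) auto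
  qed
  have "closedin (top_of_set {0..1}) {t \<in> topspace (top_of_set {0..1}). \<sigma> t \<in> ?K}"
    by (rule closedin_continuous_map_preimage[OF p closedin_chart_inv_compact[OF H c _ r(2)]]) simp
  then have T: "closed {t \<in> {0..1}. \<sigma> t \<in> ?K}" by (simp add: closedin_closed_eq)
  define E where "E = {t \<in> {0..1}. \<not> (\<sigma> t \<in> fst c \<and> snd c (\<sigma> t) \<in> ball z (2 * r))}"
  have "openin (top_of_set {0..1}) {t \<in> topspace (top_of_set {0..1}). \<sigma> t \<in> fst c \<and> snd c (\<sigma> t) \<in> ball z (2 * r)}"
    by (rule openin_preimage_chart[OF p c]) simp
  then obtain T where "open T" "{t \<in> {0..1}. \<sigma> t \<in> fst c \<and> snd c (\<sigma> t) \<in> ball z (2 * r)} = {0..1} \<inter> T"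
    by (auto simp: openin_open)
  moreover from this(2) have "E = {0..1} - T" unfolding E_def by blast
  ultimately have E: "closed E" by (simp add: closed_Diff)
  have "\<exists>\<tau>. 0 \<le> \<tau> \<and> \<tau> \<le> 1 \<and> (\<forall>t. 0 \<le> t \<and> t \<le> \<tau> \<longrightarrow> \<sigma> t \<in> fst c \<and> snd c (\<sigma> t) \<in> cball z (2 * r)) \<and>
      norm (snd c x - snd c y) \<le> 2 * norm (snd c (\<sigma> \<tau>) - snd c (\<sigma> 0))"
  proof (cases "E = {}")
    case True
    then show ?thesis
      using xy by (intro exI[of _ 1]) (auto simp: E_def norm_minus_commute less_imp_le)
  next
    case False
    \<comment> \<open>The first time outside the open ball of radius \<open>2 * r\<close>. It is
      attained because \<open>E\<close> is closed.\<close>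
    define \<tau> where "\<tau> = Inf E"
    have bdd: "bdd_below E" by (intro bdd_belowI[of _ 0]) (auto simp: E_def)
    have \<tau>: "\<tau> \<in> E" unfolding \<tau>_def by (rule closed_contains_Inf[OF False bdd E])
    have before: "t \<in> {t \<in> {0..1}. \<sigma> t \<in> ?K}" if "0 \<le> t" "t < \<tau>" for t
    proof -
      have "t \<notin> E" using cInf_lower[OF _ bdd, of t] that by (auto simp: \<tau>_def)
      then show ?thesis using that \<tau> by (auto simp: E_def inK)
    qed
    have "0 \<notin> E" using x xy r(1) by (auto simp: E_def)
    then have "0 < \<tau>" using \<tau> by (auto simp: E_def less_le)
    \<comment> \<open>Up to the exit time the curve lies in the compact ball, whose time set is
      closed, hence also at \<open>\<tau>\<close> itself. As \<open>\<tau>\<close> belongs to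
      \<open>E\<close>, the exit point is on the sphere and not outside the chart.\<close>
    have "closure {0..<\<tau>} \<subseteq> {t \<in> {0..1}. \<sigma> t \<in> ?K}"
      using before by (intro closure_minimal T) auto
    then have all: "t \<in> {t \<in> {0..1}. \<sigma> t \<in> ?K}" if "0 \<le> t" "t \<le> \<tau>" for t
      using that \<open>0 < \<tau>\<close> by auto
    then have "\<sigma> \<tau> \<in> fst c" "snd c (\<sigma> \<tau>) \<in> cball z (2 * r)" using \<open>0 < \<tau>\<close> inK[of \<tau>] by auto
    then have d\<tau>: "dist z (snd c (\<sigma> \<tau>)) = 2 * r" using \<tau> by (auto simp: E_def)
    have "dist z (snd c (\<sigma> \<tau>)) \<le> dist z (snd c x) + norm (snd c (\<sigma> \<tau>) - snd c (\<sigma> 0))"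
      using dist_triangle[of z "snd c (\<sigma> \<tau>)" "snd c x"] xy by (simp add: dist_norm norm_minus_commute)
    then have "norm (snd c (\<sigma> \<tau>) - snd c (\<sigma> 0)) \<ge> r" using d\<tau> x by simp
    \<comment> \<open>Two points of the inner ball are less than \<open>2 * r\<close> apart, at most
      twice the displacement at the exit; this is the origin of the factor
      \<open>m / 2\<close>.\<close>
    moreover have "norm (snd c x - snd c y) \<le> dist z (snd c x) + dist z (snd c y)"
      by (metis dist_commute dist_norm dist_triangle)
    ultimately have "norm (snd c x - snd c y) \<le> 2 * norm (snd c (\<sigma> \<tau>) - snd c (\<sigma> 0))"
      using x y by simp
    then show ?thesis using all inK \<open>0 < \<tau>\<close> \<tau> by (intro exI[of _ \<tau>]) (auto simp: E_def)
  qed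
  then obtain \<tau> where \<tau>: "0 \<le> \<tau>" "\<tau> \<le> 1"
    "\<And>t. 0 \<le> t \<Longrightarrow> t \<le> \<tau> \<Longrightarrow> \<sigma> t \<in> fst c \<and> snd c (\<sigma> t) \<in> cball z (2 * r)"
    "norm (snd c x - snd c y) \<le> 2 * norm (snd c (\<sigma> \<tau>) - snd c (\<sigma> 0))" by blast
  have "m / 2 * norm (snd c x - snd c y) \<le> m * norm (snd c (\<sigma> \<tau>) - snd c (\<sigma> 0))"
    using \<tau>(4) m(1) by (simp add: field_simps)
  also have "\<dots> \<le> integral {0..1} (curve_speed A g \<sigma>)"
    by (rule chart_displacement_le_length[OF g \<sigma> c \<tau>(1,2,3) m])
  finally show "ennreal (m / 2 * norm (snd c (\<sigma> 0) - snd c (\<sigma> 1))) \<le> ennreal (integral {0..1} (curve_speed A g \<sigma>))"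
    unfolding xy by (rule ennreal_leI)
qed

lemma chart_locally_lipschitz:
  assumes H: "Hausdorff_space (atlas_topology A)" and g: "riemannian_metric A g"
    and c: "c \<in> A" and x0: "x0 \<in> fst c"
  obtains N C where "open N" "snd c x0 \<in> N" "C > 0"
    "\<And>x y. x \<in> fst c \<Longrightarrow> snd c x \<in> N \<Longrightarrow> y \<in> fst c \<Longrightarrow> snd c y \<in> N \<Longrightarrow>
      ennreal (norm (snd c x - snd c y)) \<le> ennreal C * riemannian_dist A g x y"
proof -
  obtain R where R: "R > 0" "cball (snd c x0) R \<subseteq> snd c ` fst c"
    using open_chart_image[OF c] x0 open_contains_cball by blast
  \<comment> \<open>Halving leaves room for the exit argument: the ball of radius
    \<open>2 * r\<close> is the one known to lie in the chart.\<close>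
  define r where "r = R / 2"
  have r: "r > 0" "cball (snd c x0) (2 * r) \<subseteq> snd c ` fst c" using R by (auto simp: r_def)
  obtain m where m: "m > 0"
    "\<And>x v. x \<in> fst c \<Longrightarrow> snd c x \<in> cball (snd c x0) (2 * r) \<Longrightarrow> m * norm v \<le> sqrt (g x c v v)"
    using metric_lower_bound[OF g c _ r(2)] compact_cball by blast
  show ?thesis
  proof (rule that[of "ball (snd c x0) r" "2 / m"])
    fix x y assume xy: "x \<in> fst c" "snd c x \<in> ball (snd c x0) r" "y \<in> fst c" "snd c y \<in> ball (snd c x0) r"
    have "ennreal (norm (snd c x - snd c y)) = ennreal (2 / m) * ennreal (m / 2 * norm (snd c x - snd c y))"
      using m(1) by (simp flip: ennreal_mult)
    also have "\<dots> \<le> ennreal (2 / m) * riemannian_dist A g x y"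
      by (intro mult_left_mono chart_dist_le_riemannian_dist[OF H g c r m xy]) auto
    finally show "ennreal (norm (snd c x - snd c y)) \<le> ennreal (2 / m) * riemannian_dist A g x y" .
  qed (use r m in auto)
qed

end

section \<open>Energy on a Lagrangian graph\<close>

text \<open>The estimate has to hold for pairs of points neither of which is \<open>q0\<close>, so a
  derivative that vanishes at \<open>q0\<close> alone would not do; its continuity keeps it small on
  a whole ball, where the mean value inequality applies. Continuity is given direction by direction,
  hence the operator norm is controlled through \<open>B\<close>, the sum over the basis.\<close>

lemma C1_vanishing_derivative_lipschitz:
  fixes f :: "'e::euclidean_space \<Rightarrow> real"
  assumes U: "open U" "q0 \<in> U" and D: "\<And>q. q \<in> U \<Longrightarrow> (f has_derivative D q) (at q)"
    and cont: "\<And>b. continuous_on U (\<lambda>q. D q b)" and zero: "\<And>v. D q0 v = 0" and "\<epsilon> > 0"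
  obtains \<eta> where "\<eta> > 0"
    "\<And>q1 q2. q1 \<in> ball q0 \<eta> \<Longrightarrow> q2 \<in> ball q0 \<eta> \<Longrightarrow> \<bar>f q1 - f q2\<bar> \<le> \<epsilon> * norm (q1 - q2)"
proof -
  define B where "B q = (\<Sum>b\<in>Basis. \<bar>D q b\<bar>)" for q
  have "continuous_on U B" unfolding B_def using cont by (intro continuous_intros) auto
  then have "open (U \<inter> B -` {..<\<epsilon>})"
    by (rule continuous_open_preimage[OF _ U(1) open_lessThan])
  then have "open {q \<in> U. B q < \<epsilon>}" by (simp add: vimage_def Int_def)
  moreover have "q0 \<in> {q \<in> U. B q < \<epsilon>}" using U(2) zero \<open>\<epsilon> > 0\<close> by (simp add: B_def)
  ultimately obtain \<eta> where \<eta>: "\<eta> > 0" "ball q0 \<eta> \<subseteq> {q \<in> U. B q < \<epsilon>}"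
    using open_contains_ball by meson
  show ?thesis
  proof (rule that[OF \<eta>(1)])
    fix q1 q2 assume q: "q1 \<in> ball q0 \<eta>" "q2 \<in> ball q0 \<eta>"
    have "norm (f q1 - f q2) \<le> \<epsilon> * norm (q1 - q2)"
    proof (rule differentiable_bound[OF convex_ball _ _ q])
      fix q assume "q \<in> ball q0 \<eta>"
      then have q: "q \<in> U" "B q < \<epsilon>" using \<eta>(2) by auto
      show "(f has_derivative D q) (at q within ball q0 \<eta>)"
        using D[OF q(1)] by (rule has_derivative_at_withinI)
      have lin: "linear (D q)" using D[OF q(1)] has_derivative_linear by blast
      show "onorm (D q) \<le> \<epsilon>"
      proof (rule onorm_le)
        fix v
        have "D q v = D q (\<Sum>b\<in>Basis. (v \<bullet> b) *\<^sub>R b)" by (simp add: euclidean_representation)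
        also have "\<dots> = (\<Sum>b\<in>Basis. (v \<bullet> b) * D q b)"
          by (simp add: linear_sum[OF lin] linear_scale[OF lin])
        also have "norm \<dots> \<le> (\<Sum>b\<in>Basis. norm v * \<bar>D q b\<bar>)"
          by (rule sum_norm_le) (simp add: abs_mult mult_right_mono Basis_le_norm)
        also have "\<dots> = norm v * B q" by (simp add: B_def sum_distrib_left)
        also have "\<dots> \<le> \<epsilon> * norm v" using q(2) by (simp add: mult.commute mult_right_mono less_imp_le)
        finally show "norm (D q v) \<le> \<epsilon> * norm v" .
      qed
    qed
    then show "\<bar>f q1 - f q2\<bar> \<le> \<epsilon> * norm (q1 - q2)" by simp
  qed
qed

text \<open>The integral curve stays in the graph, so its velocity \<open>(u, w)\<close> satisfies \<open>w = \<sigma>' u\<close>;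
  since \<open>u\<close> and \<open>- w\<close> are the partial gradients, the symmetry of \<open>\<sigma>'\<close> makes the two
  contributions to the derivative of the energy along the graph cancel.\<close>

lemma hamiltonian_graph_critical:
  fixes L :: "'e::euclidean_space \<times> 'e \<Rightarrow> real" and \<sigma> :: "'e \<Rightarrow> 'e"
  assumes L: "linear L" and ab: "a < b" and d: "d > 0"
    and q: "((\<lambda>t. (q t, p t)) has_vector_derivative
        (\<Sum>b\<in>Basis. L (0, b) *\<^sub>R b, - (\<Sum>b\<in>Basis. L (b, 0) *\<^sub>R b))) (at a within {a..b})"
    and graph: "\<And>t. t \<in> {a..b} \<Longrightarrow> dist t a < d \<Longrightarrow> p t = \<sigma> (q t)"
    and \<sigma>: "(\<sigma> has_derivative \<sigma>') (at (q a))" and sym: "\<And>u v. \<sigma>' u \<bullet> v = \<sigma>' v \<bullet> u"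
  shows "L (v, \<sigma>' v) = 0"
proof -
  define u where "u = (\<Sum>b\<in>Basis. L (0, b) *\<^sub>R b)"
  define w where "w = (\<Sum>b\<in>Basis. L (b, 0) *\<^sub>R b)"
  have rep: "(\<Sum>b\<in>Basis. M b *\<^sub>R b) \<bullet> v = M v" if "linear M" for M :: "'e \<Rightarrow> real" and v
  proof -
    have "M v = M (\<Sum>b\<in>Basis. (v \<bullet> b) *\<^sub>R b)" by (simp add: euclidean_representation)
    also have "\<dots> = (\<Sum>b\<in>Basis. (v \<bullet> b) * M b)"
      by (simp add: linear_sum[OF that] linear_scale[OF that])
    finally have M: "M v = (\<Sum>b\<in>Basis. (v \<bullet> b) * M b)" .
    show ?thesis unfolding M by (simp add: inner_sum_left mult.commute inner_commute[of v])
  qed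
  have lin: "linear (\<lambda>x. L (0, x))" "linear (\<lambda>x. L (x, 0))"
  proof -
    have "linear (\<lambda>x :: 'e. (0 :: 'e, x))" "linear (\<lambda>x :: 'e. (x, 0 :: 'e))"
      by (rule linearI; simp)+
    from this[THEN linear_compose, OF L]
    show "linear (\<lambda>x. L (0, x))" "linear (\<lambda>x. L (x, 0))" by (simp_all only: o_def)
  qed
  have u: "u \<bullet> v = L (0, v)" and w: "w \<bullet> v = L (v, 0)" for v
    unfolding u_def w_def using rep[OF lin(1)] rep[OF lin(2)] by auto
  have q': "(q has_vector_derivative u) (at a within {a..b})"
    using bounded_linear.has_vector_derivative[OF bounded_linear_fst q] by (simp add: u_def)
  have p': "(p has_vector_derivative - w) (at a within {a..b})"
    using bounded_linear.has_vector_derivative[OF bounded_linear_snd q] by (simp add: w_def)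
  have "(\<sigma> \<circ> q has_vector_derivative \<sigma>' u) (at a within {a..b})"
    by (rule vector_derivative_diff_chain_within[OF q' has_derivative_at_withinI[OF \<sigma>]])
  \<comment> \<open>Only \<open>p\<close> and \<open>\<sigma> \<circ> q\<close> near
    \<open>a\<close> to its right are compared. One-sided derivatives are still unique because
    \<open>a < b\<close> makes \<open>a\<close> a limit point of the interval.\<close>
  then have "(p has_vector_derivative \<sigma>' u) (at a within {a..b})"
    by (rule has_vector_derivative_transform_within[OF _ d]) (use graph ab in auto)
  moreover have "at a within {a..b} \<noteq> bot"
    using ab by (simp add: trivial_limit_within islimpt_Icc)
  ultimately have "\<sigma>' u = - w"
    using p' vector_derivative_unique_within by blast
  have "L (v, \<sigma>' v) = L (v, 0) + L (0, \<sigma>' v)" by (simp flip: linear_add[OF L])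
  also have "\<dots> = w \<bullet> v + \<sigma>' u \<bullet> v" 
    using u[of "\<sigma>' v"] w[of v] sym[of u v] by (metis inner_commute)
  finally show ?thesis using \<open>\<sigma>' u = - w\<close> by simp
qed

section \<open>Integral curves inside an invariant set\<close>

lemma hamiltonian_integral_curve_subset:
  assumes "hamiltonian_integral_curve A H J \<gamma>" "I \<subseteq> J"
  shows "hamiltonian_integral_curve A H I \<gamma>"
  using assms unfolding hamiltonian_integral_curve_def
  by (meson continuous_map_from_subtopology_mono has_vector_derivative_within_subset subsetD)

text \<open>Reduces the two readings of invariance to what the velocity argument consumes: a short
  integral curve in the set that starts at the given point.\<close>

lemma invariant_integral_curve:
  assumes inv: "hamiltonian_invariant r A H L" and x: "x \<in> L"
  obtains \<gamma> a b where "a < b" "hamiltonian_integral_curve A H {a..b} \<gamma>" "\<gamma> a = x" "\<gamma> ` {a..b} \<subseteq> L"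
proof (cases "2 \<le> r")
  case True
  then have flow: "hamiltonian_flow A H t `` L = L" for t
    using inv by (simp add: hamiltonian_invariant_def)
  \<comment> \<open>Time -1 makes \<open>x\<close> the left end point of the interval. The points in
    between stay in \<open>L\<close>, since the curve restricted to the segment from 0 to
    \<open>t\<close> exhibits \<open>\<gamma> t\<close> as a flow image of \<open>y\<close>.\<close>
  then have "x \<in> hamiltonian_flow A H (-1) `` L" using x by simp
  then obtain y \<gamma> where y: "y \<in> L" and \<gamma>: "hamiltonian_integral_curve A H {-1..0} \<gamma>" "\<gamma> 0 = y" "\<gamma> (-1) = x"
    by (auto simp: hamiltonian_flow_def closed_segment_eq_real_ivl)
  have "\<gamma> t \<in> L" if "t \<in> {-1..0}" for t
  proof -
    have "hamiltonian_integral_curve A H (closed_segment 0 t) \<gamma>"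
      by (rule hamiltonian_integral_curve_subset[OF \<gamma>(1)]) (use that in \<open>auto simp: closed_segment_eq_real_ivl\<close>)
    then have "\<gamma> t \<in> hamiltonian_flow A H t `` L" using y \<gamma>(2) by (auto simp: hamiltonian_flow_def)
    then show ?thesis using flow by simp
  qed
  then have "\<gamma> ` {-1..0} \<subseteq> L" by blast
  then show ?thesis by (rule that[OF _ \<gamma>(1,3), rotated]) simp
next
  case False
  then obtain \<gamma> t where "hamiltonian_integral_curve A H UNIV \<gamma>" "\<gamma> t = x" "range \<gamma> \<subseteq> L"
    using inv x unfolding hamiltonian_invariant_def by (metis imageE)
  then show ?thesis
    using that[of t "t + 1" \<gamma>] hamiltonian_integral_curve_subset[of A H UNIV \<gamma> "{t..t + 1}"] by auto
qed

section \<open>The energy along the graph in one chart\<close>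

definition graph_coord :: "('m, 'e) chart \<Rightarrow> ('m \<Rightarrow> ('m, 'e) covec) \<Rightarrow> 'e \<Rightarrow> 'e" where
  "graph_coord c s q = s (chart_inv c q) c"

definition graph_energy ::
    "('m, 'e) chart \<Rightarrow> ('m \<Rightarrow> ('m, 'e) covec) \<Rightarrow> ('m \<times> ('m, 'e) covec \<Rightarrow> real) \<Rightarrow> 'e \<Rightarrow> real" where
  "graph_energy c s H q = H (chart_inv c q, s (chart_inv c q))"

context
  fixes A :: "('m, 'e::euclidean_space) chart set"
    and s :: "'m \<Rightarrow> ('m, 'e) covec"
    and H :: "'m \<times> ('m, 'e) covec \<Rightarrow> real"
    and r :: enat and c :: "('m, 'e) chart"
  assumes smooth: "smooth_atlas A"
    and covec: "\<And>q. q \<in> atlas_carrier A \<Longrightarrow> covector_at A q (s q)"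
    and s_C1: "\<And>c. c \<in> A \<Longrightarrow> Cr_fun_on 1 A (fst c) (\<lambda>q. s q c)"
    and r: "1 \<le> r" and H: "Cr_fun_on r (cotangent_atlas A) (cotangent_bundle A) H"
    and c: "c \<in> A"
begin

interpretation differentiable_atlas A using smooth by (rule smooth_imp_differentiable_atlas)

lemma graph_coord_C1:
  shows graph_coord_derivative: "q \<in> snd c ` fst c \<Longrightarrow>
      (graph_coord c s has_derivative frechet_derivative (graph_coord c s) (at q)) (at q)"
    and graph_coord_derivative_continuous:
      "continuous_on (snd c ` fst c) (\<lambda>q. frechet_derivative (graph_coord c s) (at q) v)"
proof -
  have "Cr_on 1 (snd c ` (fst c \<inter> fst c)) ((\<lambda>q. s q c) \<circ> chart_inv c)"
    using s_C1[OF c] c unfolding Cr_fun_on_def by blast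
  then have 1: "Cr_on 1 (snd c ` fst c) (graph_coord c s)"
    by (simp add: graph_coord_def[abs_def] o_def)
  show "q \<in> snd c ` fst c \<Longrightarrow> (graph_coord c s has_derivative frechet_derivative (graph_coord c s) (at q)) (at q)"
    using Cr_on_1D(1)[OF 1] frechet_derivative_works by auto
  show "continuous_on (snd c ` fst c) (\<lambda>q. frechet_derivative (graph_coord c s) (at q) v)"
    using Cr_on_1D(2)[OF 1] by auto
qed

lemma hamiltonian_C1:
  defines "\<Phi> \<equiv> H \<circ> chart_inv (cotangent_chart A c)"
  shows "z \<in> (snd c ` fst c) \<times> UNIV \<Longrightarrow> (\<Phi> has_derivative frechet_derivative \<Phi> (at z)) (at z)"
    and "continuous_on ((snd c ` fst c) \<times> UNIV) (\<lambda>z. frechet_derivative \<Phi> (at z) v)"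
proof -
  have "cotangent_chart A c \<in> cotangent_atlas A" using c by (simp add: cotangent_atlas_def)
  then have "Cr_on r (snd (cotangent_chart A c) ` (fst (cotangent_chart A c) \<inter> cotangent_bundle A)) \<Phi>"
    using H unfolding Cr_fun_on_def \<Phi>_def by blast
  moreover have "fst (cotangent_chart A c) \<inter> cotangent_bundle A = fst (cotangent_chart A c)"
    by (auto simp: fst_cotangent_chart)
  ultimately have 1: "Cr_on r ((snd c ` fst c) \<times> UNIV) \<Phi>"
    by (simp add: cotangent_chart_image_self[OF c])
  show "z \<in> (snd c ` fst c) \<times> UNIV \<Longrightarrow> (\<Phi> has_derivative frechet_derivative \<Phi> (at z)) (at z)"
    using Cr_on_1D(1)[OF 1 r] frechet_derivative_works by blast
  show "continuous_on ((snd c ` fst c) \<times> UNIV) (\<lambda>z. frechet_derivative \<Phi> (at z) v)"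
    by (rule Cr_on_1D(2)[OF 1 r])
qed

text \<open>The chain-rule expression for the derivative of \<open>graph_energy\<close>. It has the
  shape \<open>L (v, \<sigma>' v)\<close> in which \<open>hamiltonian_graph_critical\<close> shows
  it to vanish.\<close>

definition graph_energy_deriv :: "'e \<Rightarrow> 'e \<Rightarrow> real" where
  "graph_energy_deriv q v =
    frechet_derivative (H \<circ> chart_inv (cotangent_chart A c)) (at (q, graph_coord c s q))
      (v, frechet_derivative (graph_coord c s) (at q) v)"

lemma graph_point:
  assumes q: "q \<in> fst c"
  shows "(q, s q) \<in> fst (cotangent_chart A c)"
    and "snd (cotangent_chart A c) (q, s q) = (snd c q, graph_coord c s (snd c q))"
proof -
  have "q \<in> atlas_carrier A" using q c by (auto simp: atlas_carrier_def)
  then show "(q, s q) \<in> fst (cotangent_chart A c)"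
    using covec q by (simp add: fst_cotangent_chart cotangent_bundle_def)
  show "snd (cotangent_chart A c) (q, s q) = (snd c q, graph_coord c s (snd c q))"
    using q c by (simp add: snd_cotangent_chart graph_coord_def)
qed

lemma graph_energy_derivative:
  assumes q: "q \<in> snd c ` fst c"
  shows "(graph_energy c s H has_derivative graph_energy_deriv q) (at q)"
proof -
  let ?\<Phi> = "H \<circ> chart_inv (cotangent_chart A c)"
  have "((\<lambda>q. (q, graph_coord c s q)) has_derivative
      (\<lambda>v. (v, frechet_derivative (graph_coord c s) (at q) v))) (at q)"
    by (intro has_derivative_Pair has_derivative_ident graph_coord_derivative q)
  then have "((\<lambda>q. ?\<Phi> (q, graph_coord c s q)) has_derivative graph_energy_deriv q) (at q)"
    unfolding graph_energy_deriv_def[abs_def]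
    by (rule has_derivative_compose) (rule hamiltonian_C1(1), use q in simp)
  then show ?thesis
  proof (rule has_derivative_transform_within_open[OF _ open_chart_image[OF c] q])
    fix q assume "q \<in> snd c ` fst c"
    then obtain y where y: "y \<in> fst c" "q = snd c y" by blast
    then show "?\<Phi> (q, graph_coord c s q) = graph_energy c s H q"
      using cotangent_chart_inv[OF c graph_point(1)[OF y(1)]] c
      by (simp add: graph_energy_def graph_point(2))
  qed
qed

text \<open>Both the base point and the direction of the derivative of \<open>H\<close> move with
  \<open>q\<close>, whereas class C^1 gives continuity for fixed directions; expanding the direction
  in the basis of the product separates the two.\<close>

lemma graph_energy_deriv_continuous: "continuous_on (snd c ` fst c) (\<lambda>q. graph_energy_deriv q v)"
proof -
  let ?U = "snd c ` fst c"
  let ?D\<Phi> = "\<lambda>z. frechet_derivative (H \<circ> chart_inv (cotangent_chart A c)) (at z)"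
  let ?w = "\<lambda>q. (v, frechet_derivative (graph_coord c s) (at q) v)"
  have "continuous_on ?U (graph_coord c s)"
    using graph_coord_derivative has_derivative_continuous
    by (intro continuous_at_imp_continuous_on) blast
  then have "continuous_on ?U (\<lambda>q. ?D\<Phi> (q, graph_coord c s q) e)" for e
    by (intro continuous_on_compose2[OF hamiltonian_C1(2)] continuous_intros) auto
  moreover have "continuous_on ?U ?w"
    by (intro continuous_intros graph_coord_derivative_continuous)
  ultimately have cont: "continuous_on ?U (\<lambda>q. \<Sum>e\<in>Basis. (?w q \<bullet> e) * ?D\<Phi> (q, graph_coord c s q) e)"
    by (intro continuous_on_sum continuous_on_mult continuous_on_inner continuous_on_const)
  have "(\<Sum>e\<in>Basis. (?w q \<bullet> e) * ?D\<Phi> (q, graph_coord c s q) e) = graph_energy_deriv q v"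
    if "q \<in> ?U" for q
  proof -
    have lin: "linear (?D\<Phi> (q, graph_coord c s q))"
      using hamiltonian_C1(1) that has_derivative_linear by (metis SigmaI UNIV_I)
    have "graph_energy_deriv q v = ?D\<Phi> (q, graph_coord c s q) (\<Sum>e\<in>Basis. (?w q \<bullet> e) *\<^sub>R e)"
      unfolding graph_energy_deriv_def euclidean_representation ..
    then show ?thesis by (simp only: linear_sum[OF lin] linear_scale[OF lin] real_scaleR_def)
  qed
  then show ?thesis using continuous_on_eq[OF cont] by simp
qed

text \<open>The gradient of the local primitive is \<open>graph_coord\<close>, which yields the
  symmetry. An integral curve from \<open>x\<close> stays over the chart for a short time, and
  there, being in \<open>L\<close>, it satisfies p = s(q).\<close>

lemma graph_energy_critical:
  assumes closed: "\<forall>q0\<in>atlas_carrier A. \<exists>W S. openin (atlas_topology A) W \<and> q0 \<in> W \<and>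
        Cr_fun_on 2 A W (S :: 'm \<Rightarrow> real) \<and>
        (\<forall>q\<in>W. \<forall>c\<in>A. q \<in> fst c \<longrightarrow>
           (\<forall>v. s q c \<bullet> v = frechet_derivative (S \<circ> chart_inv c) (at (snd c q)) v))"
    and L: "L \<subseteq> (\<lambda>q. (q, s q)) ` atlas_carrier A" and inv: "hamiltonian_invariant r A H L"
    and x: "x \<in> L" "fst x \<in> fst c"
  shows "graph_energy_deriv (snd c (fst x)) v = 0"
proof -
  let ?q0 = "snd c (fst x)"
  have q0: "?q0 \<in> snd c ` fst c" using x by simp
  have inL: "y \<in> L \<Longrightarrow> snd y = s (fst y)" for y using L by auto
  have "fst x \<in> atlas_carrier A" using x c by (auto simp: atlas_carrier_def)
  then obtain W S where W: "openin (atlas_topology A) W" "fst x \<in> W"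
    and S: "Cr_fun_on 2 A W (S :: 'm \<Rightarrow> real)"
    and Ss: "\<forall>q\<in>W. \<forall>c\<in>A. q \<in> fst c \<longrightarrow>
           (\<forall>v. s q c \<bullet> v = frechet_derivative (S \<circ> chart_inv c) (at (snd c q)) v)"
    using closed by meson
  let ?X = "snd c ` (fst c \<inter> W)"
  have X: "open ?X" "?q0 \<in> ?X" using open_chart_image_openin[OF c W(1)] x W(2) by auto
  have "Cr_on 2 ?X (S \<circ> chart_inv c)" using S c unfolding Cr_fun_on_def by blast
  have S': "((S \<circ> chart_inv c) has_derivative (\<lambda>v. graph_coord c s q \<bullet> v)) (at q)" if qX: "q \<in> ?X" for q
  proof -
    obtain y where y: "y \<in> fst c" "y \<in> W" "q = snd c y" using qX by blast
    have "(S \<circ> chart_inv c) differentiable at q"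
      by (rule Cr_on_1D(1)[OF \<open>Cr_on 2 ?X (S \<circ> chart_inv c)\<close> _ qX]) simp
    then have "((S \<circ> chart_inv c) has_derivative frechet_derivative (S \<circ> chart_inv c) (at q)) (at q)"
      using frechet_derivative_works by blast
    moreover have "frechet_derivative (S \<circ> chart_inv c) (at q) = (\<lambda>v. graph_coord c s q \<bullet> v)"
      using Ss y c by (auto simp: graph_coord_def)
    ultimately show ?thesis by simp
  qed
  note sym = gradient_derivative_symmetric[OF X S' graph_coord_derivative[OF q0]]
  obtain \<gamma> a b where ab: "a < b" and \<gamma>: "hamiltonian_integral_curve A H {a..b} \<gamma>" "\<gamma> a = x" "\<gamma> ` {a..b} \<subseteq> L"
    using invariant_integral_curve[OF inv x(1)] .
  have "continuous_map (top_of_set {a..b}) (atlas_topology A) (fst \<circ> \<gamma>)"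
    using \<gamma>(1) continuous_map_cotangent_projection[OF smooth] continuous_map_compose
    unfolding hamiltonian_integral_curve_def by blast
  then have "openin (top_of_set {a..b}) {t \<in> topspace (top_of_set {a..b}). (fst \<circ> \<gamma>) t \<in> fst c}"
    using openin_continuous_map_preimage openin_chart_domain[OF c] by blast
  then obtain T where T: "open T" "{t \<in> {a..b}. fst (\<gamma> t) \<in> fst c} = {a..b} \<inter> T"
    by (auto simp: openin_open)
  have "a \<in> {a..b} \<inter> T" unfolding T(2)[symmetric] using ab \<gamma>(2) x by simp
  then obtain d where d: "d > 0" "ball a d \<subseteq> T" using T(1) open_contains_ball by blast
  have graph: "snd (\<gamma> t) c = graph_coord c s (snd c (fst (\<gamma> t)))" if "t \<in> {a..b}" "dist t a < d" for t
  proof -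
    have "t \<in> {a..b} \<inter> T" using that d(2) by (auto simp: dist_commute)
    then have "fst (\<gamma> t) \<in> fst c" unfolding T(2)[symmetric] by simp
    moreover have "snd (\<gamma> t) = s (fst (\<gamma> t))" using inL \<gamma>(3) that by blast
    ultimately show ?thesis using c by (simp add: graph_coord_def)
  qed
  let ?L = "frechet_derivative (H \<circ> chart_inv (cotangent_chart A c)) (at (?q0, graph_coord c s ?q0))"
  have xc: "snd (cotangent_chart A c) x = (?q0, graph_coord c s ?q0)"
    using graph_point(2)[OF x(2)] inL[OF x(1)] by (metis prod.collapse)
  have lin: "linear ?L"
    using hamiltonian_C1(1)[of "(?q0, graph_coord c s ?q0)"] q0 has_derivative_linear by blast
  have vel: "((\<lambda>t. (snd c (fst (\<gamma> t)), snd (\<gamma> t) c)) has_vector_derivative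
      (\<Sum>b\<in>Basis. ?L (0, b) *\<^sub>R b, - (\<Sum>b\<in>Basis. ?L (b, 0) *\<^sub>R b))) (at a within {a..b})"
  proof -
    have "((snd (cotangent_chart A c) \<circ> \<gamma>) has_vector_derivative
       hamiltonian_field A H c (snd (cotangent_chart A c) (\<gamma> a))) (at a within {a..b})"
      by (rule \<gamma>(1)[unfolded hamiltonian_integral_curve_def, THEN conjunct2, rule_format])
         (use \<gamma>(2) ab c x(2) in auto)
    then show ?thesis
      unfolding \<gamma>(2) xc hamiltonian_field_def Let_def by (simp add: o_def snd_cotangent_chart)
  qed
  have coord: "(graph_coord c s has_derivative frechet_derivative (graph_coord c s) (at ?q0)) (at (snd c (fst (\<gamma> a))))"
    using graph_coord_derivative[OF q0] \<gamma>(2) by simp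
  show ?thesis
    unfolding graph_energy_deriv_def
    by (rule hamiltonian_graph_critical[where q = "\<lambda>t. snd c (fst (\<gamma> t))" and p = "\<lambda>t. snd (\<gamma> t) c",
          OF lin ab d(1) vel graph coord sym])
qed

end

section \<open>Rectifiable paths\<close>

text \<open>The length argument stripped of geometry: \<open>\<delta> s t\<close> stands for the
  distance between the path points at \<open>s\<close> and \<open>t\<close>, and \<open>L\<close>
  for the length. A fine uniform partition bounds the total increment by \<open>\<epsilon>\<close>
  times \<open>L\<close>, which tends to 0 because \<open>L\<close> is finite.\<close>

lemma increments_eq_0:
  fixes f :: "real \<Rightarrow> real" and \<delta> :: "real \<Rightarrow> real \<Rightarrow> ennreal"
  assumes L: "L < \<infinity>"
    and sums: "\<And>n t. t 0 = 0 \<Longrightarrow> t n = 1 \<Longrightarrow> (\<forall>i<n. t i \<le> t (Suc i)) \<Longrightarrow>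
      (\<Sum>i<n. \<delta> (t i) (t (Suc i))) \<le> L"
    and small: "\<And>t0 \<epsilon>. t0 \<in> {0..1} \<Longrightarrow> \<epsilon> > 0 \<Longrightarrow> \<exists>d>0. \<forall>s\<in>{0..1} \<inter> ball t0 d. \<forall>t\<in>{0..1} \<inter> ball t0 d.
      ennreal \<bar>f s - f t\<bar> \<le> ennreal \<epsilon> * \<delta> s t"
  shows "f 0 = f 1"
proof -
  have "\<bar>f 0 - f 1\<bar> \<le> \<epsilon> * enn2real L" if \<epsilon>: "\<epsilon> > 0" for \<epsilon>
  proof -
    obtain d where d: "\<And>t0. t0 \<in> {0..1} \<Longrightarrow> d t0 > 0"
      "\<And>t0 s t. t0 \<in> {0..1} \<Longrightarrow> s \<in> {0..1} \<inter> ball t0 (d t0) \<Longrightarrow> t \<in> {0..1} \<inter> ball t0 (d t0) \<Longrightarrow>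
        ennreal \<bar>f s - f t\<bar> \<le> ennreal \<epsilon> * \<delta> s t"
      using small[OF _ \<epsilon>] by metis
    have cover: "{0..1} \<subseteq> \<Union> ((\<lambda>t0. ball t0 (d t0)) ` {0..1})" using d(1) by force
    have opn: "open B" if "B \<in> (\<lambda>t0. ball t0 (d t0)) ` {0..1}" for B using that by auto
    \<comment> \<open>A Lebesgue number of the cover: two parameters closer than \<open>e\<close>
      lie in a common ball, so the local estimate applies to consecutive partition points.\<close>
    have "\<exists>e>0. \<forall>t\<in>{0..1}. \<exists>B\<in>(\<lambda>t0. ball t0 (d t0)) ` {0..1}. ball t e \<subseteq> B"
      by (rule Heine_Borel_lemma[OF compact_Icc cover opn]) blast+
    then obtain e where e: "e > 0" "\<And>t. t \<in> {0..1} \<Longrightarrow> \<exists>B\<in>(\<lambda>t0. ball t0 (d t0)) ` {0..1}. ball t e \<subseteq> B"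
      by blast
    obtain n :: nat where n: "n > 0" "1 / real n < e"
      using e(1) by (metis nat_approx_posE zero_less_Suc)
    define t where "t i = real i / real n" for i
    have "ennreal \<bar>f (t i) - f (t (Suc i))\<bar> \<le> ennreal \<epsilon> * \<delta> (t i) (t (Suc i))" if "i < n" for i
    proof -
      have ti: "t i \<in> {0..1}" "t (Suc i) \<in> {0..1}" using that by (auto simp: t_def)
      have "dist (t i) (t (Suc i)) = 1 / real n" using n(1) by (simp add: t_def dist_real_def field_simps)
      then have "t (Suc i) \<in> ball (t i) e" "t i \<in> ball (t i) e" using n(2) e(1) by auto
      then show ?thesis using e(2)[OF ti(1)] ti d(2) by blast
    qed
    then have "(\<Sum>i<n. ennreal \<bar>f (t i) - f (t (Suc i))\<bar>) \<le> (\<Sum>i<n. ennreal \<epsilon> * \<delta> (t i) (t (Suc i)))"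
      by (intro sum_mono) auto
    also have "\<dots> = ennreal \<epsilon> * (\<Sum>i<n. \<delta> (t i) (t (Suc i)))" by (simp add: sum_distrib_left)
    also have "\<dots> \<le> ennreal \<epsilon> * L"
      using n(1) by (intro mult_left_mono sums) (auto simp: t_def divide_right_mono)
    also have "\<dots> = ennreal (\<epsilon> * enn2real L)" using L \<epsilon> by (simp add: ennreal_mult)
    finally have "ennreal (\<Sum>i<n. \<bar>f (t i) - f (t (Suc i))\<bar>) \<le> ennreal (\<epsilon> * enn2real L)" by simp
    then have "(\<Sum>i<n. \<bar>f (t i) - f (t (Suc i))\<bar>) \<le> \<epsilon> * enn2real L"
      using \<epsilon> by (subst (asm) ennreal_le_iff) auto
    moreover have "f (t 0) - f (t n) = (\<Sum>i<n. f (t i) - f (t (Suc i)))"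
      using sum_lessThan_telescope'[of "\<lambda>i. f (t i)" n] by simp
    moreover have "t 0 = 0" "t n = 1" using n(1) by (auto simp: t_def)
    ultimately show ?thesis by (simp add: order_trans[OF sum_abs])
  qed
  note bound = this
  have "\<bar>f 0 - f 1\<bar> \<le> 0 + \<epsilon>" if "\<epsilon> > 0" for \<epsilon>
  proof -
    have K: "enn2real L + 1 > 0" by (simp add: add_nonneg_pos)
    \<comment> \<open>Division by \<open>enn2real L + 1\<close> because the length may be 0.\<close>
    have "\<bar>f 0 - f 1\<bar> \<le> \<epsilon> / (enn2real L + 1) * enn2real L" using K that by (intro bound) simp
    also have "\<dots> \<le> \<epsilon>" using K that by (simp add: field_simps)
    finally show ?thesis by simp
  qed
  then have "\<bar>f 0 - f 1\<bar> \<le> 0" by (rule field_le_epsilon)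
  then show ?thesis by simp
qed

theorem theorem2:
  fixes A :: "('m, 'e::euclidean_space) chart set"
    and r :: enat
    and H :: "'m \<times> ('m, 'e) covec \<Rightarrow> real"
    and \<Gamma> \<Lambda> :: "('m \<times> ('m, 'e) covec) set"
  assumes "closed_connected_manifold A"
    and "1 \<le> r"
    and "Cr_fun_on r (cotangent_atlas A) (cotangent_bundle A) H"
    and "lagrangian_graph_C1 A \<Gamma>"
    and "\<Lambda> \<subseteq> \<Gamma>"
    and "compactin (atlas_topology (cotangent_atlas A)) \<Lambda>"
    and "connectedin (atlas_topology (cotangent_atlas A)) \<Lambda>"
    and "hamiltonian_invariant r A H \<Lambda>"
    and "\<And>x y. x \<in> \<Lambda> \<Longrightarrow> y \<in> \<Lambda> \<Longrightarrow>
           \<exists>\<gamma>. rectifiable_path_on (cotangent_atlas A) \<gamma> \<and> \<gamma> ` {0..1} \<subseteq> \<Lambda> \<and> \<gamma> 0 = x \<and> \<gamma> 1 = y"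
  shows "H constant_on \<Lambda>"
proof -
  have smooth: "smooth_atlas A" and Hausdorff: "Hausdorff_space (atlas_topology A)"
    using assms(1) by (auto simp: closed_connected_manifold_def smooth_manifold_def)
  interpret differentiable_atlas A using smooth by (rule smooth_imp_differentiable_atlas)
  interpret T: differentiable_atlas "cotangent_atlas A" using smooth by (rule differentiable_cotangent_atlas)
  note HT = Hausdorff_cotangent[OF smooth Hausdorff]
  obtain s where \<Gamma>: "\<Gamma> = (\<lambda>q. (q, s q)) ` atlas_carrier A"
    and covec: "\<And>q. q \<in> atlas_carrier A \<Longrightarrow> covector_at A q (s q)"
    and s_C1: "\<And>c. c \<in> A \<Longrightarrow> Cr_fun_on 1 A (fst c) (\<lambda>q. s q c)"
    and closed: "\<forall>q0\<in>atlas_carrier A. \<exists>W S. openin (atlas_topology A) W \<and> q0 \<in> W \<and>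
        Cr_fun_on 2 A W (S :: 'm \<Rightarrow> real) \<and>
        (\<forall>q\<in>W. \<forall>c\<in>A. q \<in> fst c \<longrightarrow>
           (\<forall>v. s q c \<bullet> v = frechet_derivative (S \<circ> chart_inv c) (at (snd c q)) v))"
    using assms(4) unfolding lagrangian_graph_C1_def by blast
  have L: "\<Lambda> \<subseteq> (\<lambda>q. (q, s q)) ` atlas_carrier A" using assms(5) \<Gamma> by simp
  have "H x = H y" if xy: "x \<in> \<Lambda>" "y \<in> \<Lambda>" for x y
  proof -
    obtain \<gamma> where \<gamma>: "rectifiable_path_on (cotangent_atlas A) \<gamma>" "\<gamma> ` {0..1} \<subseteq> \<Lambda>" "\<gamma> 0 = x" "\<gamma> 1 = y"
      using assms(9)[OF xy] by blast
    obtain g where g: "riemannian_metric (cotangent_atlas A) g" "path_length (cotangent_atlas A) g \<gamma> < \<infinity>"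
      and p: "continuous_map (top_of_set {0..1}) (atlas_topology (cotangent_atlas A)) \<gamma>"
      using \<gamma>(1) by (auto simp: rectifiable_path_on_def pathin_def)
    let ?\<delta> = "\<lambda>s t. riemannian_dist (cotangent_atlas A) g (\<gamma> s) (\<gamma> t)"
    have "(\<Sum>i<n. ?\<delta> (t i) (t (Suc i))) \<le> path_length (cotangent_atlas A) g \<gamma>"
      if "t 0 = 0" "t n = 1" "\<forall>i<n. t i \<le> t (Suc i)" for n t
      unfolding path_length_def by (rule SUP_upper2[of "(n, t)"]) (use that in auto)
    moreover have "\<exists>d>0. \<forall>s\<in>{0..1} \<inter> ball t0 d. \<forall>t\<in>{0..1} \<inter> ball t0 d.
        ennreal \<bar>(H \<circ> \<gamma>) s - (H \<circ> \<gamma>) t\<bar> \<le> ennreal \<epsilon> * ?\<delta> s t"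
      if t0: "t0 \<in> {0..1}" and \<epsilon>: "\<epsilon> > 0" for t0 \<epsilon>
    proof -
      have \<Lambda>0: "\<gamma> t0 \<in> \<Lambda>" using \<gamma>(2) t0 by blast
      then obtain c where c: "c \<in> A" "fst (\<gamma> t0) \<in> fst c"
        using L by (auto simp: atlas_carrier_def)
      let ?C = "cotangent_chart A c" and ?q0 = "snd c (fst (\<gamma> t0))"
      have C: "?C \<in> cotangent_atlas A" using c by (simp add: cotangent_atlas_def)
      have graph: "\<gamma> t = (fst (\<gamma> t), s (fst (\<gamma> t)))" if "t \<in> {0..1}" for t
        using \<gamma>(2) L that by force
      note facts = smooth covec s_C1 assms(2,3) c(1)
      have "\<gamma> t0 \<in> fst ?C"
        using graph_point(1)[OF facts c(2)] graph[OF t0] by simp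
      then obtain N K where N: "open N" "snd ?C (\<gamma> t0) \<in> N" and K: "K > 0"
        and NK: "\<And>x y. x \<in> fst ?C \<Longrightarrow> snd ?C x \<in> N \<Longrightarrow> y \<in> fst ?C \<Longrightarrow> snd ?C y \<in> N \<Longrightarrow>
          ennreal (norm (snd ?C x - snd ?C y)) \<le> ennreal K * riemannian_dist (cotangent_atlas A) g x y"
        using T.chart_locally_lipschitz[OF HT g(1) C] by metis
      have q0: "?q0 \<in> snd c ` fst c" using c(2) by blast
      \<comment> \<open>\<open>K\<close> is the local factor between coordinate and Riemannian
        distance. Asking for the Lipschitz constant \<open>\<epsilon> / K\<close> lets it cancel at
        the end.\<close>
      have "\<exists>\<eta>>0. \<forall>q1\<in>ball ?q0 \<eta>. \<forall>q2\<in>ball ?q0 \<eta>.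
          \<bar>graph_energy c s H q1 - graph_energy c s H q2\<bar> \<le> \<epsilon> / K * norm (q1 - q2)"
        by (rule C1_vanishing_derivative_lipschitz[OF open_chart_image[OF c(1)] q0
            graph_energy_derivative[OF facts] graph_energy_deriv_continuous[OF facts]
            graph_energy_critical[OF facts closed L assms(8) \<Lambda>0 c(2)] divide_pos_pos[OF \<epsilon> K]]) blast+
      then obtain \<eta> where \<eta>: "\<eta> > 0"
        "\<And>q1 q2. q1 \<in> ball ?q0 \<eta> \<Longrightarrow> q2 \<in> ball ?q0 \<eta> \<Longrightarrow>
          \<bar>graph_energy c s H q1 - graph_energy c s H q2\<bar> \<le> \<epsilon> / K * norm (q1 - q2)"
        by blast
      \<comment> \<open>\<open>N\<close> is the domain of the distance comparison, which involves
        all canonical coordinates; the ball restricts the base coordinates only, on which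
        \<open>graph_energy\<close> depends.\<close>
      let ?V = "N \<inter> ball ?q0 \<eta> \<times> UNIV"
      have "openin (top_of_set {0..1}) {t \<in> topspace (top_of_set {0..1}). \<gamma> t \<in> fst ?C \<and> snd ?C (\<gamma> t) \<in> ?V}"
        using N(1) by (intro T.openin_preimage_chart[OF p C]) (auto intro: open_Times)
      then obtain T where T: "open T" "{t \<in> {0..1}. \<gamma> t \<in> fst ?C \<and> snd ?C (\<gamma> t) \<in> ?V} = {0..1} \<inter> T"
        by (auto simp: openin_open)
      have "t0 \<in> {0..1} \<inter> T"
        unfolding T(2)[symmetric] using t0 \<open>\<gamma> t0 \<in> fst ?C\<close> N(2) \<eta>(1) by (simp add: snd_cotangent_chart)
      then obtain d where d: "d > 0" "ball t0 d \<subseteq> T" using T(1) open_contains_ball by blast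
      show ?thesis
      proof (intro exI[of _ d] conjI d(1) ballI)
        fix u t assume "u \<in> {0..1} \<inter> ball t0 d" "t \<in> {0..1} \<inter> ball t0 d"
        then have "u \<in> {0..1} \<inter> T" "t \<in> {0..1} \<inter> T" using d(2) by auto
        then have u: "u \<in> {0..1}" "\<gamma> u \<in> fst ?C" "snd ?C (\<gamma> u) \<in> ?V"
          and t: "t \<in> {0..1}" "\<gamma> t \<in> fst ?C" "snd ?C (\<gamma> t) \<in> ?V"
          unfolding T(2)[symmetric] by auto
        have E: "H (\<gamma> t) = graph_energy c s H (snd c (fst (\<gamma> t)))" if "t \<in> {0..1}" "\<gamma> t \<in> fst ?C" for t
          using graph[OF that(1)] that(2) c(1) by (simp add: graph_energy_def fst_cotangent_chart)
        have "\<bar>H (\<gamma> u) - H (\<gamma> t)\<bar> \<le> \<epsilon> / K * norm (snd c (fst (\<gamma> u)) - snd c (fst (\<gamma> t)))"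
          unfolding E[OF u(1,2)] E[OF t(1,2)] using u(3) t(3) by (intro \<eta>(2)) (auto simp: snd_cotangent_chart)
        \<comment> \<open>The projection to the base coordinates does not increase the norm, so the
          distance in the cotangent bundle controls the energy increment.\<close>
        also have "\<dots> \<le> \<epsilon> / K * norm (snd ?C (\<gamma> u) - snd ?C (\<gamma> t))"
          using norm_fst_le[of "snd c (fst (\<gamma> u)) - snd c (fst (\<gamma> t))" "snd (\<gamma> u) c - snd (\<gamma> t) c"] \<epsilon> K
          by (intro mult_left_mono) (auto simp: snd_cotangent_chart)
        finally have "ennreal \<bar>H (\<gamma> u) - H (\<gamma> t)\<bar> \<le> ennreal (\<epsilon> / K) * ennreal (norm (snd ?C (\<gamma> u) - snd ?C (\<gamma> t)))"
          using \<epsilon> K by (simp add: ennreal_leI flip: ennreal_mult)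
        also have "\<dots> \<le> ennreal (\<epsilon> / K) * (ennreal K * ?\<delta> u t)"
          using u t by (intro mult_left_mono NK) auto
        also have "\<dots> = ennreal \<epsilon> * ?\<delta> u t"
          using \<epsilon> K by (simp flip: mult.assoc ennreal_mult)
        finally show "ennreal \<bar>(H \<circ> \<gamma>) u - (H \<circ> \<gamma>) t\<bar> \<le> ennreal \<epsilon> * ?\<delta> u t" by simp
      qed
    qed
    ultimately have "(H \<circ> \<gamma>) 0 = (H \<circ> \<gamma>) 1" by (rule increments_eq_0[OF g(2)])
    then show ?thesis using \<gamma>(3,4) by simp
  qed
  then show ?thesis unfolding constant_on_def by metis
qed

end
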